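(* Let $k$ be a field with $\operatorname{char} k\neq 2$, let $n$ be a non-negative integer and let $A$ be a finite-dimensional $k$-algebra. The right $E(n)$-comodule algebra structures on $A$ are exactly the $k$-linear maps $\rho: A\to A\otimes E(n)$ of the form \[\rho(a)=\sum_{P\subseteq\{1,\ldots,n\}}(-1)^{\lfloor\frac{|P|+1}{2}\rfloor}\left[d_P(a)\otimes\frac{x_P+(-1)^{|P|}gx_P}{2}+\varphi(d_P(a))\otimes\frac{x_P+(-1)^{|P|+1}gx_P}{2}\right]\qquad (a\in A),\] where: (1) $\varphi$ is a $k$-algebra automorphism of $A$ with $\varphi^2=\mathrm{Id}_A$; (2) $d_1,\ldots,d_n: A\to A$ are $\varphi$-derivations such that $d_i^2=0$, $\varphi d_i=-d_i\varphi$ and $d_id_j=-d_jd_i$ for all $i,j=1,\ldots,n$; and $d_\emptyset=\mathrm{Id}_A$, $d_P=d_{i_1}d_{i_2}\cdots d_{i_s}$ (composition) for $P=\{i_1<i_2<\cdots<i_s\}$.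
   Context: Algebras are associative and unital; $\otimes=\otimes_k$. $E(n)$ is the $2^{n+1}$-dimensional Hopf algebra over $k$ generated by $g,x_1,\ldots,x_n$ with relations $g^2=1$, $x_i^2=0$, $gx_i=-x_ig$, $x_ix_j=-x_jx_i$, and with $\Delta(g)=g\otimes g$, $\Delta(x_i)=x_i\otimes g+1\otimes x_i$, $\varepsilon(g)=1$, $\varepsilon(x_i)=0$, $S(g)=g$, $S(x_i)=gx_i$. For $P=\{i_1<\cdots<i_s\}\subseteq\{1,\ldots,n\}$ put $x_P=x_{i_1}\cdots x_{i_s}$, with $x_\emptyset=1$; the elements $g^jx_P$ ($j\in\{0,1\}$) form a $k$-basis of $E(n)$. A right $H$-comodule algebra structure (a right $H$-coaction) on an algebra $A$ is a $k$-linear map $\rho:A\to A\otimes H$, $\rho(a)=a_0\otimes a_1$, making $A$ a right $H$-comodule and satisfying $\rho(ab)=a_0b_0\otimes a_1b_1$ and $\rho(1_A)=1_A\otimes 1_H$. For an algebra map $\varphi:A\to A$, a $\varphi$-derivation is a $k$-linear map $d:A\to A$ with $d(ab)=d(a)b+\varphi(a)d(b)$ for all $a,b\in A$. *)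

theory Defs
  imports Complex_Main "HOL-Library.Function_Algebras"
begin

section \<open>Algebras\<close>

text \<open>
  The sort \<open>{ring, monoid_mult}\<close> describes associative unital, not necessarily commutative rings.
  Unlike \<^class>\<open>ring_1\<close> it does not exclude the zero ring.
\<close>

locale k_algebra = vector_space scale
  for scale :: "'k::field \<Rightarrow> 'a::{ring,monoid_mult} \<Rightarrow> 'a" +
  assumes scale_mult_left: "scale c a * b = scale c (a * b)"
    and scale_mult_right: "a * scale c b = scale c (a * b)"

definition finite_dimensional :: "('k::field \<Rightarrow> 'a::ab_group_add \<Rightarrow> 'a) \<Rightarrow> bool" where
  "finite_dimensional s \<longleftrightarrow> (\<exists>B. finite B \<and> module.span s B = UNIV)"

definition algebra_map ::
  "('k::field \<Rightarrow> 'a::{ring,monoid_mult} \<Rightarrow> 'a) \<Rightarrow> ('k \<Rightarrow> 'b::{ring,monoid_mult} \<Rightarrow> 'b) \<Rightarrow> ('a \<Rightarrow> 'b) \<Rightarrow> bool"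
where
  "algebra_map sA sB f \<longleftrightarrow>
     Vector_Spaces.linear sA sB f \<and> (\<forall>a b. f (a * b) = f a * f b) \<and> f 1 = 1"

definition algebra_automorphism ::
  "('k::field \<Rightarrow> 'a::{ring,monoid_mult} \<Rightarrow> 'a) \<Rightarrow> ('a \<Rightarrow> 'a) \<Rightarrow> bool"
where
  "algebra_automorphism sA f \<longleftrightarrow> algebra_map sA sA f \<and> bij f"

definition subalgebra :: "('k::field \<Rightarrow> 'a::{ring,monoid_mult} \<Rightarrow> 'a) \<Rightarrow> 'a set \<Rightarrow> bool" where
  "subalgebra s B \<longleftrightarrow> module.subspace s B \<and> 1 \<in> B \<and> (\<forall>a\<in>B. \<forall>b\<in>B. a * b \<in> B)"

definition generated_by :: "('k::field \<Rightarrow> 'a::{ring,monoid_mult} \<Rightarrow> 'a) \<Rightarrow> 'a set \<Rightarrow> bool" where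
  "generated_by s X \<longleftrightarrow> (\<forall>B. subalgebra s B \<and> X \<subseteq> B \<longrightarrow> B = UNIV)"

definition skew_derivation ::
  "('k::field \<Rightarrow> 'a::{ring,monoid_mult} \<Rightarrow> 'a) \<Rightarrow> ('a \<Rightarrow> 'a) \<Rightarrow> ('a \<Rightarrow> 'a) \<Rightarrow> bool"
where
  "skew_derivation s \<phi> d \<longleftrightarrow>
     Vector_Spaces.linear s s d \<and> (\<forall>a b. d (a * b) = d a * b + \<phi> a * d b)"


section \<open>Tensor products over a field\<close>

definition bilinear_map ::
  "('k::field \<Rightarrow> 'v::ab_group_add \<Rightarrow> 'v) \<Rightarrow> ('k \<Rightarrow> 'w::ab_group_add \<Rightarrow> 'w) \<Rightarrow>
   ('k \<Rightarrow> 'u::ab_group_add \<Rightarrow> 'u) \<Rightarrow> ('v \<Rightarrow> 'w \<Rightarrow> 'u) \<Rightarrow> bool"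
where
  "bilinear_map sV sW sU f \<longleftrightarrow>
     (\<forall>v. Vector_Spaces.linear sW sU (\<lambda>w. f v w)) \<and>
     (\<forall>w. Vector_Spaces.linear sV sU (\<lambda>v. f v w))"

text \<open>
  Over a field, \<open>V \<otimes> W\<close> embeds into the dual of the space of bilinear forms on \<open>V \<times> W\<close>, with
  \<open>v \<otimes> w\<close> acting as evaluation at \<open>(v, w)\<close>.  The tensor product is realised as the span of these
  evaluation functionals; the scalings of \<open>V\<close> and \<open>W\<close> only enter in deciding which forms are bilinear,
  and the value at forms that are not bilinear is set to zero.  The lemmas at the end of this
  section show that this is the tensor product, i.e. that it has the universal property.

  The type of tensors is larger than the tensor product, which is the set \<open>tensor_space sV sW\<close>.
  For iterated tensor products the ambient type is itself used as a factor, with scalar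
  multiplication \<open>tensor_scale\<close>.  Since every bilinear form on a pair of subspaces extends to the
  ambient spaces, the tensors \<open>t \<otimes> u\<close> with \<open>t\<close> in \<open>V \<otimes> W\<close> span \<open>(V \<otimes> W) \<otimes> U\<close>.
\<close>

type_synonym ('k, 'v, 'w) tensor = "('v \<Rightarrow> 'w \<Rightarrow> 'k) \<Rightarrow> 'k"

definition tensor_scale :: "'k::field \<Rightarrow> ('k, 'v, 'w) tensor \<Rightarrow> ('k, 'v, 'w) tensor" where
  "tensor_scale c t = (\<lambda>\<beta>. c * t \<beta>)"

definition pure_tensor ::
  "('k::field \<Rightarrow> 'v::ab_group_add \<Rightarrow> 'v) \<Rightarrow> ('k \<Rightarrow> 'w::ab_group_add \<Rightarrow> 'w) \<Rightarrow>
   'v \<Rightarrow> 'w \<Rightarrow> ('k, 'v, 'w) tensor"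
where
  "pure_tensor sV sW v w = (\<lambda>\<beta>. if bilinear_map sV sW (*) \<beta> then \<beta> v w else 0)"

definition tensor_space ::
  "('k::field \<Rightarrow> 'v::ab_group_add \<Rightarrow> 'v) \<Rightarrow> ('k \<Rightarrow> 'w::ab_group_add \<Rightarrow> 'w) \<Rightarrow>
   ('k, 'v, 'w) tensor set"
where
  "tensor_space sV sW = module.span tensor_scale (range (\<lambda>(v, w). pure_tensor sV sW v w))"

text \<open>
  For bilinear \<open>f\<close>, \<open>tensor_lift sV sW f\<close> is the induced linear map on \<open>V \<otimes> W\<close>, which sends
  \<open>\<Sum>i. v\<^sub>i \<otimes> w\<^sub>i\<close> to \<open>\<Sum>i. f v\<^sub>i w\<^sub>i\<close>.
\<close>

definition tensor_lift ::
  "('k::field \<Rightarrow> 'v::ab_group_add \<Rightarrow> 'v) \<Rightarrow> ('k \<Rightarrow> 'w::ab_group_add \<Rightarrow> 'w) \<Rightarrow>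
   ('v \<Rightarrow> 'w \<Rightarrow> 'u::ab_group_add) \<Rightarrow> ('k, 'v, 'w) tensor \<Rightarrow> 'u"
where
  "tensor_lift sV sW f t =
     (THE u. \<exists>ps. t = (\<Sum>(v, w)\<leftarrow>ps. pure_tensor sV sW v w) \<and> u = (\<Sum>(v, w)\<leftarrow>ps. f v w))"

text \<open>\<open>(a \<otimes> b) (a' \<otimes> b') = a a' \<otimes> b b'\<close>\<close>

definition tensor_mult ::
  "('k::field \<Rightarrow> 'a::{ring,monoid_mult} \<Rightarrow> 'a) \<Rightarrow> ('k \<Rightarrow> 'b::{ring,monoid_mult} \<Rightarrow> 'b) \<Rightarrow>
   ('k, 'a, 'b) tensor \<Rightarrow> ('k, 'a, 'b) tensor \<Rightarrow> ('k, 'a, 'b) tensor"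
where
  "tensor_mult sA sB t t' =
     tensor_lift sA sB
       (\<lambda>a b. tensor_lift sA sB (\<lambda>a' b'. pure_tensor sA sB (a * a') (b * b')) t') t"

lemma vector_space_tensor_scale: "vector_space tensor_scale"
  by unfold_locales (auto simp: tensor_scale_def fun_eq_iff algebra_simps)

lemma linear_functional_separates:
  assumes "vector_space (s :: 'k::field \<Rightarrow> 'u::ab_group_add \<Rightarrow> 'u)" and "u \<noteq> 0"
  obtains l where "Vector_Spaces.linear s (*) l" and "l u \<noteq> (0::'k)"
proof -
  interpret vector_space s by fact
  interpret K: vector_space "(*) :: 'k \<Rightarrow> 'k \<Rightarrow> 'k" by unfold_locales (auto simp: algebra_simps)
  have ind: "independent {u}" using \<open>u \<noteq> 0\<close> by simp
  define B where "B = extend_basis {u}"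
  have B: "independent B" "span B = UNIV" "u \<in> B"
    using ind extend_basis_superset[OF ind] independent_extend_basis span_extend_basis
    by (auto simp: B_def)
  have "Vector_Spaces.linear s (*) (\<lambda>v. representation B v u)"
    by unfold_locales (use B in \<open>auto simp: representation_add representation_scale\<close>)
  moreover have "representation B u u \<noteq> 0" using B by (simp add: representation_basis)
  ultimately show thesis by (rule that)
qed

lemma bilinear_mapI:
  assumes "vector_space sV" "vector_space sW" "vector_space sU"
    and "\<And>v v' w. f (v + v') w = f v w + f v' w" "\<And>v w w'. f v (w + w') = f v w + f v w'"
    and "\<And>c v w. f (sV c v) w = sU c (f v w)" "\<And>c v w. f v (sW c w) = sU c (f v w)"
  shows "bilinear_map sV sW sU f"
proof -
  interpret V: vector_space sV by fact
  interpret W: vector_space sW by fact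
  interpret U: vector_space sU by fact
  show ?thesis
    unfolding bilinear_map_def by (intro conjI allI; unfold_locales) (simp_all add: assms(4-7))
qed

lemma bilinear_mapD:
  assumes "bilinear_map sV sW sU f"
  shows "f (v + v') w = f v w + f v' w" "f v (w + w') = f v w + f v w'"
    and "f (sV c v) w = sU c (f v w)" "f v (sW c w) = sU c (f v w)"
  using assms
  by (auto simp: bilinear_map_def dest: Vector_Spaces.linear.axioms(3)
      module_hom.add module_hom.scale)

lemma bilinear_map_spaces:
  assumes "bilinear_map sV sW sU f"
  shows "vector_space sV" "vector_space sW" "vector_space sU"
  using assms by (auto simp: bilinear_map_def dest: Vector_Spaces.linear.axioms(1,2))

lemma bilinear_pure_tensor:
  assumes "vector_space sV" "vector_space sW"
  shows "bilinear_map sV sW tensor_scale (pure_tensor sV sW)"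
  by (rule bilinear_mapI[OF assms vector_space_tensor_scale])
    (auto simp: pure_tensor_def tensor_scale_def fun_eq_iff dest: bilinear_mapD)

lemma sum_pure_tensor_apply:
  "bilinear_map sV sW (*) \<beta> \<Longrightarrow>
    (\<Sum>(v, w)\<leftarrow>ps. pure_tensor sV sW v w) \<beta> = (\<Sum>(v, w)\<leftarrow>ps. \<beta> v w)"
  by (induction ps) (auto simp: pure_tensor_def)

lemma linear_sum_list:
  assumes "Vector_Spaces.linear s s' l"
  shows "l (\<Sum>(v, w)\<leftarrow>ps. f v w) = (\<Sum>(v, w)\<leftarrow>ps. l (f v w))"
proof -
  interpret Vector_Spaces.linear s s' l by fact
  show ?thesis by (induction ps) (auto simp: add)
qed

lemma tensor_lift_well_defined:
  assumes f: "bilinear_map sV sW sU f"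
    and eq: "(\<Sum>(v, w)\<leftarrow>ps. pure_tensor sV sW v w) = (\<Sum>(v, w)\<leftarrow>qs. pure_tensor sV sW v w)"
  shows "(\<Sum>(v, w)\<leftarrow>ps. f v w) = (\<Sum>(v, w)\<leftarrow>qs. f v w)"
proof (rule ccontr)
  let ?S = "\<lambda>ps. \<Sum>(v, w)\<leftarrow>ps. f v w"
  assume "?S ps \<noteq> ?S qs"
  then have "?S ps - ?S qs \<noteq> 0" by simp
  with bilinear_map_spaces(3)[OF f] obtain l
    where l: "Vector_Spaces.linear sU (*) l" and "l (?S ps - ?S qs) \<noteq> 0"
    by (rule linear_functional_separates)
  interpret l: Vector_Spaces.linear sU "(*)" l by fact
  from \<open>l (?S ps - ?S qs) \<noteq> 0\<close> have ne: "l (?S ps) \<noteq> l (?S qs)" by (simp add: l.diff)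
  have "bilinear_map sV sW (*) (\<lambda>v w. l (f v w))"
    by (rule bilinear_mapI[OF bilinear_map_spaces(1,2)[OF f]])
      (auto simp: bilinear_mapD[OF f] l.add l.scale l.vs2.vector_space_axioms)
  with eq have "(\<Sum>(v, w)\<leftarrow>ps. l (f v w)) = (\<Sum>(v, w)\<leftarrow>qs. l (f v w))"
    by (metis (no_types, lifting) sum_pure_tensor_apply)
  with ne show False by (simp add: linear_sum_list[OF l])
qed

lemma tensor_lift_sum:
  assumes "bilinear_map sV sW sU f"
  shows "tensor_lift sV sW f (\<Sum>(v, w)\<leftarrow>ps. pure_tensor sV sW v w) = (\<Sum>(v, w)\<leftarrow>ps. f v w)"
  unfolding tensor_lift_def
proof (rule the_equality)
  fix u
  assume "\<exists>qs. (\<Sum>(v, w)\<leftarrow>ps. pure_tensor sV sW v w) = (\<Sum>(v, w)\<leftarrow>qs. pure_tensor sV sW v w) \<and>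
    u = (\<Sum>(v, w)\<leftarrow>qs. f v w)"
  then obtain qs
    where "(\<Sum>(v, w)\<leftarrow>ps. pure_tensor sV sW v w) = (\<Sum>(v, w)\<leftarrow>qs. pure_tensor sV sW v w)"
      and "u = (\<Sum>(v, w)\<leftarrow>qs. f v w)" by blast
  with tensor_lift_well_defined[OF assms] show "u = (\<Sum>(v, w)\<leftarrow>ps. f v w)" by metis
qed blast

lemma tensor_space_iff:
  assumes "vector_space sV" "vector_space sW"
  shows "t \<in> tensor_space sV sW \<longleftrightarrow> (\<exists>ps. t = (\<Sum>(v, w)\<leftarrow>ps. pure_tensor sV sW v w))"
proof
  note D = bilinear_mapD[OF bilinear_pure_tensor[OF assms]]
  interpret T: vector_space "tensor_scale :: _ \<Rightarrow> ('a, 'b, 'c) tensor \<Rightarrow> _"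
    by (rule vector_space_tensor_scale)
  let ?S = "\<lambda>ps. \<Sum>(v, w)\<leftarrow>ps. pure_tensor sV sW v w"
  show "\<exists>ps. t = ?S ps" if "t \<in> tensor_space sV sW"
    using that unfolding tensor_space_def
  proof (induction rule: T.span_induct_alt)
    case base
    show ?case by (rule exI[of _ "[]"]) simp
  next
    case (step c x y)
    then obtain v w ps where "x = pure_tensor sV sW v w" "y = ?S ps" by auto
    then have "tensor_scale c x + y = ?S ((sV c v, w) # ps)" by (simp add: D)
    then show ?case by blast
  qed
  show "t \<in> tensor_space sV sW" if "\<exists>ps. t = ?S ps"
  proof -
    from that obtain ps where "t = ?S ps" ..
    moreover have "?S ps \<in> tensor_space sV sW"
      unfolding tensor_space_def
      by (induction ps)
        (simp_all add: case_prod_unfold T.span_zero T.span_add T.span_base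
          del: plus_fun_apply zero_fun_apply)
    ultimately show ?thesis by simp
  qed
qed

theorem tensor_space_universal_property:
  assumes f: "bilinear_map sV sW sU f"
  defines "F \<equiv> tensor_lift sV sW f"
  shows "F (pure_tensor sV sW v w) = f v w"
    and "t \<in> tensor_space sV sW \<Longrightarrow> t' \<in> tensor_space sV sW \<Longrightarrow> F (t + t') = F t + F t'"
    and "t \<in> tensor_space sV sW \<Longrightarrow> F (tensor_scale c t) = sU c (F t)"
    and "Vector_Spaces.linear tensor_scale sU G \<Longrightarrow> (\<And>v w. G (pure_tensor sV sW v w) = f v w) \<Longrightarrow>
           t \<in> tensor_space sV sW \<Longrightarrow> G t = F t"
proof -
  note vs = bilinear_map_spaces[OF f]
  note D = bilinear_mapD[OF bilinear_pure_tensor[OF vs(1,2)]]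
  let ?S = "\<lambda>ps. \<Sum>(v, w)\<leftarrow>ps. pure_tensor sV sW v w"
  note L = tensor_lift_sum[OF f]
  interpret T: vector_space "tensor_scale :: _ \<Rightarrow> ('a, 'b, 'c) tensor \<Rightarrow> _"
    by (rule vector_space_tensor_scale)
  interpret U: vector_space sU by fact
  show "F (pure_tensor sV sW v w) = f v w"
    using L[of "[(v, w)]"] by (simp add: F_def)
  show "F (t + t') = F t + F t'" if "t \<in> tensor_space sV sW" "t' \<in> tensor_space sV sW"
  proof -
    from that obtain ps qs where *: "t = ?S ps" "t' = ?S qs"
      by (auto simp: tensor_space_iff[OF vs(1,2)])
    then have "t + t' = ?S (ps @ qs)" by simp
    then show ?thesis by (simp only: F_def * L) simp
  qed
  show "F (tensor_scale c t) = sU c (F t)" if t: "t \<in> tensor_space sV sW"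
  proof -
    from t obtain ps where *: "t = ?S ps" by (auto simp: tensor_space_iff[OF vs(1,2)])
    let ?qs = "map (\<lambda>(v, w). (sV c v, w)) ps"
    have "tensor_scale c t = ?S ?qs"
      unfolding * by (induction ps) (simp_all add: case_prod_unfold D T.scale_right_distrib
            del: plus_fun_apply zero_fun_apply)
    moreover have "sU c (\<Sum>(v, w)\<leftarrow>ps. f v w) = (\<Sum>(v, w)\<leftarrow>?qs. f v w)"
      by (induction ps) (auto simp: bilinear_mapD[OF f] U.scale_right_distrib)
    ultimately show ?thesis by (simp only: F_def * L)
  qed
  show "G t = F t" if G: "Vector_Spaces.linear tensor_scale sU G"
    "\<And>v w. G (pure_tensor sV sW v w) = f v w" and t: "t \<in> tensor_space sV sW"
  proof -
    from t obtain ps where *: "t = ?S ps" by (auto simp: tensor_space_iff[OF vs(1,2)])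
    show ?thesis unfolding * F_def L linear_sum_list[OF G(1)] by (simp add: G(2))
  qed
qed


section \<open>Hopf algebras and comodule algebras\<close>

text \<open>
  \<open>(V \<otimes> H) \<otimes> H\<close> and \<open>V \<otimes> (H \<otimes> H)\<close> are identified, so that coassociativity
  \<open>(\<rho> \<otimes> id) \<circ> \<rho> = (id \<otimes> \<Delta>) \<circ> \<rho>\<close> is an equation in \<open>(V \<otimes> H) \<otimes> H\<close>.
\<close>

locale right_comodule =
  V: vector_space sV + H: vector_space sH
  for sV :: "'k::field \<Rightarrow> 'v::ab_group_add \<Rightarrow> 'v"
    and sH :: "'k \<Rightarrow> 'h::ab_group_add \<Rightarrow> 'h"
    and \<Delta> :: "'h \<Rightarrow> ('k, 'h, 'h) tensor" and \<epsilon> :: "'h \<Rightarrow> 'k"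
    and \<rho> :: "'v \<Rightarrow> ('k, 'v, 'h) tensor" +
  assumes linear_coaction: "Vector_Spaces.linear sV tensor_scale \<rho>"
    and coaction_in_tensor_space: "\<rho> v \<in> tensor_space sV sH"
    and coaction_coassoc:
      "tensor_lift sV sH (\<lambda>v\<^sub>0 v\<^sub>1. pure_tensor tensor_scale sH (\<rho> v\<^sub>0) v\<^sub>1) (\<rho> v) =
       tensor_lift sV sH
         (\<lambda>v\<^sub>0 v\<^sub>1. tensor_lift sH sH
           (\<lambda>h\<^sub>1 h\<^sub>2. pure_tensor tensor_scale sH (pure_tensor sV sH v\<^sub>0 h\<^sub>1) h\<^sub>2) (\<Delta> v\<^sub>1)) (\<rho> v)"
    and coaction_counit: "tensor_lift sV sH (\<lambda>v\<^sub>0 v\<^sub>1. sV (\<epsilon> v\<^sub>1) v\<^sub>0) (\<rho> v) = v"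

text \<open>
  The coassociativity and one half of the counit axiom of a coalgebra \<open>H\<close> say that \<open>\<Delta>\<close> is a right
  coaction of \<open>H\<close> on itself.
\<close>

locale hopf_algebra =
  k_algebra scale + right_comodule scale scale \<Delta> \<epsilon> \<Delta>
  for scale :: "'k::field \<Rightarrow> 'h::{ring,monoid_mult} \<Rightarrow> 'h"
    and \<Delta> :: "'h \<Rightarrow> ('k, 'h, 'h) tensor" and \<epsilon> :: "'h \<Rightarrow> 'k" and S :: "'h \<Rightarrow> 'h" +
  assumes comult_counit_left: "tensor_lift scale scale (\<lambda>h\<^sub>1 h\<^sub>2. scale (\<epsilon> h\<^sub>1) h\<^sub>2) (\<Delta> h) = h"
    and comult_mult: "\<Delta> (h * h') = tensor_mult scale scale (\<Delta> h) (\<Delta> h')"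
    and comult_one: "\<Delta> 1 = pure_tensor scale scale 1 1"
    and algebra_map_counit: "algebra_map scale (*) \<epsilon>"
    and linear_antipode: "Vector_Spaces.linear scale scale S"
    and antipode_left: "tensor_lift scale scale (\<lambda>h\<^sub>1 h\<^sub>2. S h\<^sub>1 * h\<^sub>2) (\<Delta> h) = scale (\<epsilon> h) 1"
    and antipode_right: "tensor_lift scale scale (\<lambda>h\<^sub>1 h\<^sub>2. h\<^sub>1 * S h\<^sub>2) (\<Delta> h) = scale (\<epsilon> h) 1"

locale right_comodule_algebra =
  k_algebra sA + right_comodule sA sH \<Delta> \<epsilon> \<rho>
  for sA :: "'k::field \<Rightarrow> 'a::{ring,monoid_mult} \<Rightarrow> 'a"
    and sH :: "'k \<Rightarrow> 'h::{ring,monoid_mult} \<Rightarrow> 'h"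
    and \<Delta> :: "'h \<Rightarrow> ('k, 'h, 'h) tensor" and \<epsilon> :: "'h \<Rightarrow> 'k"
    and \<rho> :: "'a \<Rightarrow> ('k, 'a, 'h) tensor" +
  assumes coaction_mult: "\<rho> (a * b) = tensor_mult sA sH (\<rho> a) (\<rho> b)"
    and coaction_one: "\<rho> 1 = pure_tensor sA sH 1 1"


section \<open>The Hopf algebras \<open>E(n)\<close>\<close>

text \<open>
  \<open>E(n)\<close> is determined up to isomorphism by this locale: the algebra presented by the generators
  \<open>g, x\<^sub>1, \<dots>, x\<^sub>n\<close> and the relations has dimension \<open>2 ^ (n + 1)\<close>, so it is isomorphic to every
  algebra of that dimension that is generated by elements satisfying the relations.  Only the
  values of \<open>x\<close> on \<open>{1..n}\<close> matter.
\<close>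

locale E_hopf_algebra = hopf_algebra scale \<Delta> \<epsilon> S
  for scale :: "'k::field \<Rightarrow> 'h::{ring,monoid_mult} \<Rightarrow> 'h"
    and \<Delta> :: "'h \<Rightarrow> ('k, 'h, 'h) tensor" and \<epsilon> :: "'h \<Rightarrow> 'k" and S :: "'h \<Rightarrow> 'h"
    and n :: nat and g :: 'h and x :: "nat \<Rightarrow> 'h" +
  assumes generated: "generated_by scale ({g} \<union> x ` {1..n})"
    and dimension: "vector_space.dim scale (UNIV :: 'h set) = 2 ^ (n + 1)"
    and g_squared: "g ^ 2 = 1"
    and x_squared: "i \<in> {1..n} \<Longrightarrow> x i ^ 2 = 0"
    and g_x: "i \<in> {1..n} \<Longrightarrow> g * x i = - (x i * g)"
    and x_x: "i \<in> {1..n} \<Longrightarrow> j \<in> {1..n} \<Longrightarrow> x i * x j = - (x j * x i)"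
    and comult_g: "\<Delta> g = pure_tensor scale scale g g"
    and comult_x: "i \<in> {1..n} \<Longrightarrow>
      \<Delta> (x i) = pure_tensor scale scale (x i) g + pure_tensor scale scale 1 (x i)"
    and counit_g: "\<epsilon> g = 1"
    and counit_x: "i \<in> {1..n} \<Longrightarrow> \<epsilon> (x i) = 0"
    and antipode_g: "S g = g"
    and antipode_x: "i \<in> {1..n} \<Longrightarrow> S (x i) = g * x i"

definition ordered_prod :: "(nat \<Rightarrow> 'h::monoid_mult) \<Rightarrow> nat set \<Rightarrow> 'h" where
  "ordered_prod x P = prod_list (map x (sorted_list_of_set P))"

definition ordered_comp :: "(nat \<Rightarrow> 'a \<Rightarrow> 'a) \<Rightarrow> nat set \<Rightarrow> 'a \<Rightarrow> 'a" where
  "ordered_comp d P = foldr (\<circ>) (map d (sorted_list_of_set P)) id"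

end

theory Submission
  imports Defs
begin

text \<open>
  Write \<open>H\<close> for \<open>E(n)\<close> and put \<open>e\<^sub>0 = (1 + g)/2\<close>, \<open>e\<^sub>1 = (1 - g)/2\<close> and
  \<open>E\<^sub>i = d\<^sub>i \<phi>\<close>.  Moving all copies of \<open>\<phi>\<close> in \<open>E\<^sub>P\<close> to the left gives
  \<open>E\<^sub>P = (-1)\<^bsup>\<lfloor>(|P| + 1)/2\<rfloor>\<^esup> \<phi>\<^bsup>|P|\<^esup> d\<^sub>P\<close>, and these are exactly the signs of the closed formula, which
  thus becomes \<open>\<rho>(a) = \<Sum>\<^sub>P (E\<^sub>P(a) \<otimes> e\<^sub>0 x\<^sub>P + \<phi>(E\<^sub>P(a)) \<otimes> e\<^sub>1 x\<^sub>P)\<close>.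
  In the algebra \<open>End(A) \<otimes> H\<close> the right-hand side is the product
  \<open>(1 \<otimes> e\<^sub>0 + \<phi> \<otimes> e\<^sub>1) (1 + E\<^sub>1 \<otimes> x\<^sub>1) \<cdots> (1 + E\<^sub>n \<otimes> x\<^sub>n)\<close> applied to \<open>a \<otimes> 1\<close>.  The map
  \<open>coact k\<close> is the product of the first \<open>k + 1\<close> factors, and it satisfies
  \<open>coact (k + 1) a = coact k a + coact k (E\<^bsub>k+1\<^esub> a) (1 \<otimes> x\<^bsub>k+1\<^esub>)\<close>.  The formula is therefore never
  expanded in order to verify an axiom.

  From the data to the coaction, every axiom is an induction on \<open>k\<close>.  Multiplicativity rests on
  \<open>(1 \<otimes> x\<^sub>i) coact k b = coact k (\<phi> b) (1 \<otimes> x\<^sub>i)\<close> (\<open>left_mult_x_coact\<close>), which turns the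
  rule \<open>E\<^sub>i(ab) = E\<^sub>i(a) \<phi>(b) + a E\<^sub>i(b)\<close> into the expansion of a product.  Coassociativity rests on
  \<open>(E\<^sub>i \<otimes> id) coact k a = coact k (E\<^sub>i a) (1 \<otimes> g)\<close> (\<open>E_left_coact\<close>), which matches
  \<open>\<Delta>(x\<^sub>i) = x\<^sub>i \<otimes> g + 1 \<otimes> x\<^sub>i\<close>.

  Conversely, a functional \<open>F\<close> on \<open>H\<close> acts on a comodule by \<open>a \<mapsto> a\<^sub>0 F(a\<^sub>1)\<close>.  The dimension of \<open>H\<close>
  makes the monomials \<open>g\<^sup>j x\<^sub>P\<close> a basis, so there is a character \<open>parity\<close> that sends \<open>g\<close> to \<open>-1\<close>
  and every \<open>x\<^sub>i\<close> to \<open>0\<close>, and there are skew derivations \<open>partial i\<close> dual to the \<open>x\<^sub>i\<close>; the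
  former acts on \<open>A\<close> as \<open>\<phi>\<close> and the latter as the \<open>E\<^sub>i\<close>.  By coassociativity the relations
  between these operators follow from the same relations on \<open>H\<close> itself, with coaction \<open>\<Delta>\<close>, where both sides are determined by their values
  on \<open>g\<close> and the \<open>x\<^sub>i\<close>.  It remains to see that \<open>\<rho>\<close> is the coaction built from these operators.  For \<open>H\<close>
  this holds because \<open>coact n\<close> and \<open>\<Delta>\<close> are algebra maps that agree on the generators
  (\<open>coact_ops\<close>).  Applying \<open>\<epsilon> \<otimes> id\<close> yields a Taylor expansion of every \<open>h\<close> in \<open>H\<close>, and
  expanding the second tensor factor of \<open>\<rho>(a)\<close> in this way gives the claim for \<open>A\<close>
  (\<open>coaction_eq_coact\<close>).
\<close>

text \<open>Otherwise the simplifier turns the index set \<open>{1..n}\<close> into \<open>{Suc 0..n}\<close>.\<close>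

declare One_nat_def [simp del]

section \<open>Linear maps on tensor products\<close>

text \<open>
  Tensors are functions, but the rewriting below treats them as vectors: evaluating a sum of
  tensors argumentwise would destroy the terms to which linearity applies.
\<close>

declare zero_fun_apply [simp del] plus_fun_apply [simp del] uminus_apply [simp del]
  minus_apply [simp del]

lemma linearI:
  assumes "vector_space s" "vector_space s'"
    and "\<And>u v. f (u + v) = f u + f v" "\<And>c v. f (s c v) = s' c (f v)"
  shows "Vector_Spaces.linear s s' f"
  using assms by (simp add: Vector_Spaces.linear_iff)

lemma linearD:
  assumes "Vector_Spaces.linear s s' f"
  shows "f (u + v) = f u + f v" "f (s c v) = s' c (f v)" "f 0 = 0" "f (- v) = - f v"
    "f (u - v) = f u - f v"
proof -
  interpret Vector_Spaces.linear s s' f by fact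
  show "f (u + v) = f u + f v" "f (s c v) = s' c (f v)" "f 0 = 0" "f (- v) = - f v"
    "f (u - v) = f u - f v" by (simp_all add: add scale neg diff)
qed

lemma linear_vector_spaces:
  assumes "Vector_Spaces.linear s s' f"
  shows "vector_space s" "vector_space s'"
  using assms by (simp_all add: Vector_Spaces.linear_iff)

lemma linear_comp:
  assumes "Vector_Spaces.linear s s' f" "Vector_Spaces.linear s' s'' f'"
  shows "Vector_Spaces.linear s s'' (\<lambda>v. f' (f v))"
  using assms by (simp add: Vector_Spaces.linear_iff)

lemma linear_id_map: "vector_space s \<Longrightarrow> Vector_Spaces.linear s s (\<lambda>v. v)"
  by (simp add: Vector_Spaces.linear_iff)

lemma vector_space_field: "vector_space ((*) :: 'k::field \<Rightarrow> 'k \<Rightarrow> 'k)"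
  by unfold_locales (auto simp: algebra_simps)

lemma tensor_scale_add: "tensor_scale c (t + t') = tensor_scale c t + tensor_scale c t'"
  by (auto simp: tensor_scale_def fun_eq_iff plus_fun_apply algebra_simps)

lemma tensor_scale_commute: "tensor_scale c (tensor_scale c' t) = tensor_scale c' (tensor_scale c t)"
  by (simp add: tensor_scale_def fun_eq_iff mult.left_commute)

lemma tensor_scale_zero [simp]: "tensor_scale c 0 = 0"
  by (auto simp: tensor_scale_def fun_eq_iff zero_fun_apply)

text \<open>
  Precomposition defines \<open>f \<otimes> F\<close> on the whole function type of tensors, where it is additive
  without any side condition; \<open>tensor_lift\<close> is additive only on the tensor product itself.  This
  matters for iterated tensor products, whose factors live in the ambient type.
\<close>

definition tensor_map ::
  "('k::field \<Rightarrow> 'v2::ab_group_add \<Rightarrow> 'v2) \<Rightarrow> ('k \<Rightarrow> 'w2::ab_group_add \<Rightarrow> 'w2) \<Rightarrow>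
   ('v \<Rightarrow> 'v2) \<Rightarrow> ('w \<Rightarrow> 'w2) \<Rightarrow> ('k, 'v, 'w) tensor \<Rightarrow> ('k, 'v2, 'w2) tensor"
where
  "tensor_map sV sW f F t =
     (\<lambda>\<beta>. if bilinear_map sV sW (*) \<beta> then t (\<lambda>v w. \<beta> (f v) (F w)) else 0)"

lemma tensor_map_add: "tensor_map sV sW f F (t + t') = tensor_map sV sW f F t + tensor_map sV sW f F t'"
  by (auto simp: tensor_map_def fun_eq_iff plus_fun_apply zero_fun_apply uminus_apply)

lemma tensor_map_zero: "tensor_map sV sW f F 0 = 0"
  by (auto simp: tensor_map_def fun_eq_iff plus_fun_apply zero_fun_apply uminus_apply)

lemma tensor_map_uminus: "tensor_map sV sW f F (- t) = - tensor_map sV sW f F t"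
  by (auto simp: tensor_map_def fun_eq_iff plus_fun_apply zero_fun_apply uminus_apply)

lemma tensor_map_diff: "tensor_map sV sW f F (t - t') = tensor_map sV sW f F t - tensor_map sV sW f F t'"
  by (auto simp: tensor_map_def fun_eq_iff zero_fun_apply minus_apply)

lemma tensor_map_scale:
  "tensor_map sV sW f F (tensor_scale c t) = tensor_scale c (tensor_map sV sW f F t)"
  by (auto simp: tensor_map_def fun_eq_iff plus_fun_apply zero_fun_apply uminus_apply tensor_scale_def)

lemma linear_tensor_map: "Vector_Spaces.linear tensor_scale tensor_scale (tensor_map sV sW f F)"
  by (intro linearI vector_space_tensor_scale tensor_map_add tensor_map_scale)

lemma tensor_map_pure:
  assumes f: "Vector_Spaces.linear sV sV' f" and F: "Vector_Spaces.linear sW sW' F"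
  shows "tensor_map sV' sW' f F (pure_tensor sV sW v w) = pure_tensor sV' sW' (f v) (F w)"
proof -
  have "bilinear_map sV sW (*) (\<lambda>v w. \<beta> (f v) (F w))" if "bilinear_map sV' sW' (*) \<beta>" for \<beta>
    by (rule bilinear_mapI[OF linear_vector_spaces(1)[OF f] linear_vector_spaces(1)[OF F]
          vector_space_field])
      (simp_all add: bilinear_mapD[OF that] linearD[OF f] linearD[OF F])
  then show ?thesis
    by (auto simp: tensor_map_def pure_tensor_def fun_eq_iff)
qed

locale tensor_product = V: vector_space sV + W: vector_space sW
  for sV :: "'k::field \<Rightarrow> 'v::ab_group_add \<Rightarrow> 'v" and sW :: "'k \<Rightarrow> 'w::ab_group_add \<Rightarrow> 'w"
begin

abbreviation pure :: "'v \<Rightarrow> 'w \<Rightarrow> ('k, 'v, 'w) tensor" where "pure \<equiv> pure_tensor sV sW"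

abbreviation tensors :: "('k, 'v, 'w) tensor set" where "tensors \<equiv> tensor_space sV sW"

lemma bilinear_pure: "bilinear_map sV sW tensor_scale pure"
  by (intro bilinear_pure_tensor V.vector_space_axioms W.vector_space_axioms)

lemmas pure_add_left = bilinear_mapD(1)[OF bilinear_pure]
  and pure_add_right = bilinear_mapD(2)[OF bilinear_pure]
  and pure_scale_left = bilinear_mapD(3)[OF bilinear_pure]
  and pure_scale_right = bilinear_mapD(4)[OF bilinear_pure]

lemma linear_pure_left: "Vector_Spaces.linear sV tensor_scale (\<lambda>v. pure v w)"
  and linear_pure_right: "Vector_Spaces.linear sW tensor_scale (pure v)"
  using bilinear_pure by (simp_all add: bilinear_map_def)

lemmas pure_zero_left = linearD(3)[OF linear_pure_left]
  and pure_zero_right = linearD(3)[OF linear_pure_right]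
  and pure_uminus_left = linearD(4)[OF linear_pure_left]
  and pure_uminus_right = linearD(4)[OF linear_pure_right]
  and pure_diff_left = linearD(5)[OF linear_pure_left]
  and pure_diff_right = linearD(5)[OF linear_pure_right]

lemma subspace_tensors: "module.subspace tensor_scale tensors"
proof -
  interpret T: vector_space "tensor_scale :: 'k \<Rightarrow> ('k, 'v, 'w) tensor \<Rightarrow> _"
    by (rule vector_space_tensor_scale)
  show ?thesis unfolding tensor_space_def by (rule T.subspace_span)
qed

lemma tensors_closed:
  shows pure_in_tensors: "pure v w \<in> tensors"
    and zero_in_tensors: "0 \<in> tensors"
    and add_in_tensors: "t \<in> tensors \<Longrightarrow> t' \<in> tensors \<Longrightarrow> t + t' \<in> tensors"
proof -
  interpret T: vector_space "tensor_scale :: 'k \<Rightarrow> ('k, 'v, 'w) tensor \<Rightarrow> _"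
    by (rule vector_space_tensor_scale)
  show "pure v w \<in> tensors"
    unfolding tensor_space_def by (rule T.span_base) auto
  show "0 \<in> tensors" "t \<in> tensors \<Longrightarrow> t' \<in> tensors \<Longrightarrow> t + t' \<in> tensors"
    using subspace_tensors by (simp_all add: T.subspace_def)
qed

text \<open>
  Scalars are absorbed into the pure tensors, so an identity between additive maps only has to
  be checked on pure tensors.
\<close>

lemma tensors_induct [consumes 1, case_names zero add]:
  assumes "t \<in> tensors" and "P 0"
    and "\<And>v w t. t \<in> tensors \<Longrightarrow> P t \<Longrightarrow> P (pure v w + t)"
  shows "P t"
proof -
  interpret T: vector_space "tensor_scale :: 'k \<Rightarrow> ('k, 'v, 'w) tensor \<Rightarrow> _"
    by (rule vector_space_tensor_scale)
  from assms(1) have "t \<in> tensors \<and> P t"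
    unfolding tensor_space_def
  proof (induction rule: T.span_induct_alt)
    case base
    then show ?case using assms(2) T.span_zero by blast
  next
    case (step c u t)
    then obtain v w where u: "u = pure v w" by auto
    have *: "tensor_scale c u = pure (sV c v) w" by (simp add: u pure_scale_left)
    from step have "t \<in> tensors" "P t" by (auto simp: tensor_space_def)
    then have "pure (sV c v) w + t \<in> tensors" "P (pure (sV c v) w + t)"
      using assms(3) by (auto intro: add_in_tensors pure_in_tensors)
    then show ?case unfolding * by (simp add: tensor_space_def)
  qed
  then show ?thesis ..
qed

context
  fixes sU :: "'k \<Rightarrow> 'u::ab_group_add \<Rightarrow> 'u" and f :: "'v \<Rightarrow> 'w \<Rightarrow> 'u"
  assumes f: "bilinear_map sV sW sU f"
begin

lemma lift_pure: "tensor_lift sV sW f (pure v w) = f v w"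
  by (rule tensor_space_universal_property(1)[OF f])

lemma lift_add:
  "t \<in> tensors \<Longrightarrow> t' \<in> tensors \<Longrightarrow>
    tensor_lift sV sW f (t + t') = tensor_lift sV sW f t + tensor_lift sV sW f t'"
  by (rule tensor_space_universal_property(2)[OF f])

lemma lift_scale:
  "t \<in> tensors \<Longrightarrow> tensor_lift sV sW f (tensor_scale c t) = sU c (tensor_lift sV sW f t)"
  by (rule tensor_space_universal_property(3)[OF f])

lemma lift_zero: "tensor_lift sV sW f 0 = 0"
  using lift_add[OF zero_in_tensors zero_in_tensors] by simp

lemma lift_pure_add:
  "t \<in> tensors \<Longrightarrow> tensor_lift sV sW f (pure v w + t) = f v w + tensor_lift sV sW f t"
  by (simp add: lift_add pure_in_tensors lift_pure)

end

lemma tensor_map_in_tensors: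
  fixes sV' :: "'k \<Rightarrow> 'v2::ab_group_add \<Rightarrow> 'v2" and sW' :: "'k \<Rightarrow> 'w2::ab_group_add \<Rightarrow> 'w2"
  assumes f: "Vector_Spaces.linear sV sV' f" and F: "Vector_Spaces.linear sW sW' F"
    and t: "t \<in> tensors"
  shows "tensor_map sV' sW' f F t \<in> tensor_space sV' sW'"
proof -
  interpret T': tensor_product sV' sW'
    by (intro tensor_product.intro linear_vector_spaces(2)[OF f] linear_vector_spaces(2)[OF F])
  show ?thesis
    using t by (induction rule: tensors_induct)
      (simp_all add: tensor_map_zero tensor_map_add tensor_map_pure[OF f F] T'.tensors_closed)
qed

lemma lift_eq_tensor_map:
  fixes sV' :: "'k \<Rightarrow> 'v2::ab_group_add \<Rightarrow> 'v2" and sW' :: "'k \<Rightarrow> 'w2::ab_group_add \<Rightarrow> 'w2"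
  assumes f: "Vector_Spaces.linear sV sV' f" and F: "Vector_Spaces.linear sW sW' F"
    and t: "t \<in> tensors"
  shows "tensor_lift sV sW (\<lambda>v w. pure_tensor sV' sW' (f v) (F w)) t = tensor_map sV' sW' f F t"
proof -
  interpret T': tensor_product sV' sW'
    by (intro tensor_product.intro linear_vector_spaces(2)[OF f] linear_vector_spaces(2)[OF F])
  have bil: "bilinear_map sV sW tensor_scale (\<lambda>v w. pure_tensor sV' sW' (f v) (F w))"
    by (intro bilinear_mapI V.vector_space_axioms W.vector_space_axioms vector_space_tensor_scale)
      (simp_all add: linearD[OF f] linearD[OF F] T'.pure_add_left T'.pure_add_right
        T'.pure_scale_left T'.pure_scale_right)
  show ?thesis
    using t by (induction rule: tensors_induct)
      (simp_all add: tensor_map_zero tensor_map_add tensor_map_pure[OF f F] lift_zero[OF bil]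
        lift_pure_add[OF bil])
qed

lemma tensor_map_ident: "t \<in> tensors \<Longrightarrow> tensor_map sV sW (\<lambda>v. v) (\<lambda>w. w) t = t"
  by (induction rule: tensors_induct)
    (simp_all add: tensor_map_zero tensor_map_add tensor_map_pure linear_id_map
      V.vector_space_axioms W.vector_space_axioms)

text \<open>The slices \<open>id \<otimes> F\<close> and \<open>F \<otimes> id\<close> of a tensor along a linear functional.\<close>

definition slice :: "('w \<Rightarrow> 'k) \<Rightarrow> ('k, 'v, 'w) tensor \<Rightarrow> 'v" where
  "slice F = tensor_lift sV sW (\<lambda>v w. sV (F w) v)"

definition slice_left :: "('v \<Rightarrow> 'k) \<Rightarrow> ('k, 'v, 'w) tensor \<Rightarrow> 'w" where
  "slice_left F = tensor_lift sV sW (\<lambda>v w. sW (F v) w)"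

lemma bilinear_slice:
  assumes "Vector_Spaces.linear sW (*) F"
  shows "bilinear_map sV sW sV (\<lambda>v w. sV (F w) v)"
  by (intro bilinear_mapI V.vector_space_axioms W.vector_space_axioms)
    (simp_all add: linearD[OF assms] V.scale_right_distrib V.scale_left_distrib mult.commute)

lemma bilinear_slice_left:
  assumes "Vector_Spaces.linear sV (*) F"
  shows "bilinear_map sV sW sW (\<lambda>v w. sW (F v) w)"
  by (intro bilinear_mapI V.vector_space_axioms W.vector_space_axioms)
    (simp_all add: linearD[OF assms] W.scale_right_distrib W.scale_left_distrib mult.commute)

lemma slice_simps:
  assumes "Vector_Spaces.linear sW (*) F"
  shows "slice F (pure v w) = sV (F w) v" "slice F 0 = 0"
    and "t \<in> tensors \<Longrightarrow> t' \<in> tensors \<Longrightarrow> slice F (t + t') = slice F t + slice F t'"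
    and "t \<in> tensors \<Longrightarrow> slice F (tensor_scale c t) = sV c (slice F t)"
  unfolding slice_def
  by (simp_all add: lift_pure[OF bilinear_slice[OF assms]] lift_zero[OF bilinear_slice[OF assms]]
      lift_add[OF bilinear_slice[OF assms]] lift_scale[OF bilinear_slice[OF assms]])

lemma slice_left_simps:
  assumes "Vector_Spaces.linear sV (*) F"
  shows "slice_left F (pure v w) = sW (F v) w" "slice_left F 0 = 0"
    and "t \<in> tensors \<Longrightarrow> t' \<in> tensors \<Longrightarrow>
      slice_left F (t + t') = slice_left F t + slice_left F t'"
    and "t \<in> tensors \<Longrightarrow> slice_left F (tensor_scale c t) = sW c (slice_left F t)"
  unfolding slice_left_def
  by (simp_all add: lift_pure[OF bilinear_slice_left[OF assms]]
      lift_zero[OF bilinear_slice_left[OF assms]] lift_add[OF bilinear_slice_left[OF assms]]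
      lift_scale[OF bilinear_slice_left[OF assms]])

lemma slice_tensor_map:
  fixes sV' :: "'k \<Rightarrow> 'v2::ab_group_add \<Rightarrow> 'v2" and sW' :: "'k \<Rightarrow> 'w2::ab_group_add \<Rightarrow> 'w2"
  assumes f: "Vector_Spaces.linear sV sV' f" and F: "Vector_Spaces.linear sW sW' F"
    and L: "Vector_Spaces.linear sW' (*) L" and t: "t \<in> tensors"
  shows "tensor_product.slice sV' sW' L (tensor_map sV' sW' f F t) = f (slice (\<lambda>w. L (F w)) t)"
proof -
  interpret T': tensor_product sV' sW'
    by (intro tensor_product.intro linear_vector_spaces(2)[OF f] linear_vector_spaces(2)[OF F])
  note LF = linear_comp[OF F L]
  show ?thesis
    using t by (induction rule: tensors_induct)
      (simp_all add: tensor_map_zero tensor_map_add tensor_map_pure[OF f F] T'.slice_simps[OF L]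
        slice_simps[OF LF] T'.tensors_closed tensors_closed tensor_map_in_tensors[OF f F]
        linearD[OF f])
qed

lemma slice_uminus_functional:
  assumes "Vector_Spaces.linear sW (*) F" "Vector_Spaces.linear sW (*) (\<lambda>w. - F w)" "t \<in> tensors"
  shows "slice (\<lambda>w. - F w) t = - slice F t"
  using assms(3) by (induction rule: tensors_induct)
    (simp_all add: slice_simps[OF assms(1)] slice_simps[OF assms(2)] pure_in_tensors)

lemma tensor_map_functional:
  assumes F: "Vector_Spaces.linear sW (*) F" and "t \<in> tensors"
  shows "tensor_map sV sW (\<lambda>v. v) (\<lambda>w. sW (F w) u) t = pure (slice F t) u"
proof -
  have "Vector_Spaces.linear sW sW (\<lambda>w. sW (F w) u)"
    by (intro linearI W.vector_space_axioms) (simp_all add: linearD[OF F] W.scale_left_distrib)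
  note map_pure = tensor_map_pure[OF linear_id_map[OF V.vector_space_axioms] this]
  from assms(2) show ?thesis
    by (induction rule: tensors_induct)
      (simp_all add: tensor_map_zero tensor_map_add map_pure slice_simps[OF F] pure_zero_left
        pure_in_tensors pure_add_left pure_scale_left pure_scale_right)
qed

lemma linear_slice:
  assumes F: "Vector_Spaces.linear sW (*) F" and \<rho>: "Vector_Spaces.linear s tensor_scale \<rho>"
    and "\<And>u. \<rho> u \<in> tensors"
  shows "Vector_Spaces.linear s sV (\<lambda>u. slice F (\<rho> u))"
  by (intro linearI linear_vector_spaces(1)[OF \<rho>] V.vector_space_axioms)
    (simp_all add: linearD[OF \<rho>] slice_simps[OF F] assms(3))

end

section \<open>Tensor products of algebras\<close>

locale tensor_algebra = A: k_algebra sA + B: k_algebra sB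
  for sA :: "'k::field \<Rightarrow> 'a::{ring,monoid_mult} \<Rightarrow> 'a"
    and sB :: "'k \<Rightarrow> 'b::{ring,monoid_mult} \<Rightarrow> 'b"
begin

sublocale tensor_product sA sB ..

abbreviation mult (infixl "\<bullet>" 70) where "t \<bullet> t' \<equiv> tensor_mult sA sB t t'"

text \<open>
  Multiplication by \<open>1 \<otimes> h\<close> from the right and from the left.
\<close>

definition right_mult :: "'b \<Rightarrow> ('k, 'a, 'b) tensor \<Rightarrow> ('k, 'a, 'b) tensor" where
  "right_mult h = tensor_map sA sB (\<lambda>a. a) (\<lambda>b. b * h)"

definition left_mult :: "'b \<Rightarrow> ('k, 'a, 'b) tensor \<Rightarrow> ('k, 'a, 'b) tensor" where
  "left_mult h = tensor_map sA sB (\<lambda>a. a) (\<lambda>b. h * b)"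

lemma linear_mult_left: "Vector_Spaces.linear sA sA (\<lambda>b. a * b)"
  and linear_mult_right: "Vector_Spaces.linear sA sA (\<lambda>b. b * a)"
  by (intro linearI A.vector_space_axioms;
      simp add: algebra_simps A.scale_mult_left A.scale_mult_right)+

lemma linear_mult_left': "Vector_Spaces.linear sB sB (\<lambda>b. h * b)"
  and linear_mult_right': "Vector_Spaces.linear sB sB (\<lambda>b. b * h)"
  by (intro linearI B.vector_space_axioms;
      simp add: algebra_simps B.scale_mult_left B.scale_mult_right)+

lemma right_mult_simps:
  "right_mult h (pure a b) = pure a (b * h)"
  "right_mult h 0 = 0" "right_mult h (t + t') = right_mult h t + right_mult h t'"
  "right_mult h (tensor_scale c t) = tensor_scale c (right_mult h t)"
  "right_mult h (- t) = - right_mult h t" "right_mult h (t - t') = right_mult h t - right_mult h t'"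
  by (simp_all add: right_mult_def tensor_map_pure linear_id_map A.vector_space_axioms
      linear_mult_right' tensor_map_zero tensor_map_add tensor_map_scale tensor_map_uminus
      tensor_map_diff)

lemma left_mult_simps:
  "left_mult h (pure a b) = pure a (h * b)"
  "left_mult h 0 = 0" "left_mult h (t + t') = left_mult h t + left_mult h t'"
  by (simp_all add: left_mult_def tensor_map_pure linear_id_map A.vector_space_axioms
      linear_mult_left' tensor_map_zero tensor_map_add)

lemma right_mult_in_tensors: "t \<in> tensors \<Longrightarrow> right_mult h t \<in> tensors"
  unfolding right_mult_def
  by (intro tensor_map_in_tensors linear_id_map A.vector_space_axioms linear_mult_right')

lemma left_mult_in_tensors: "t \<in> tensors \<Longrightarrow> left_mult h t \<in> tensors"
  unfolding left_mult_def
  by (intro tensor_map_in_tensors linear_id_map A.vector_space_axioms linear_mult_left')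

lemma inner_lift:
  "t \<in> tensors \<Longrightarrow>
    tensor_lift sA sB (\<lambda>a' b'. pure (a * a') (b * b')) t = tensor_map sA sB (\<lambda>a'. a * a') (\<lambda>b'. b * b') t"
  by (intro lift_eq_tensor_map linear_mult_left linear_mult_left')

text \<open>
  The nested lifts that define \<open>t \<bullet> t'\<close> are covered by the universal property only if the inner
  one is bilinear in the components of the left factor.
\<close>

lemma bilinear_inner:
  assumes t: "t \<in> tensors"
  shows "bilinear_map sA sB tensor_scale
    (\<lambda>a b. tensor_lift sA sB (\<lambda>a' b'. pure (a * a') (b * b')) t)"
  unfolding inner_lift[OF t]
proof (intro bilinear_mapI A.vector_space_axioms B.vector_space_axioms vector_space_tensor_scale)
  let ?m = "\<lambda>a b. tensor_map sA sB (\<lambda>a'. a * a') (\<lambda>b'. b * b')"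
  note simps = tensor_map_zero tensor_map_add tensor_map_pure linear_mult_left linear_mult_left'
  show "?m (a + a') b t = ?m a b t + ?m a' b t" for a a' b
    using t by (induction rule: tensors_induct)
      (simp_all add: simps pure_add_left linear_mult_left[of "a' + a", unfolded distrib_right]
        distrib_right add_ac)
  show "?m a (b + b') t = ?m a b t + ?m a b' t" for a b b'
    using t by (induction rule: tensors_induct)
      (simp_all add: simps pure_add_right linear_mult_left'[of "b' + b", unfolded distrib_right]
        distrib_right add_ac)
  show "?m (sA c a) b t = tensor_scale c (?m a b t)" for c a b
    using t by (induction rule: tensors_induct)
      (simp_all add: simps pure_scale_left linear_mult_left[of "sA c a", unfolded A.scale_mult_left]
        A.scale_mult_left tensor_scale_add)
  show "?m a (sB c b) t = tensor_scale c (?m a b t)" for c a b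
    using t by (induction rule: tensors_induct)
      (simp_all add: simps pure_scale_right linear_mult_left'[of "sB c b", unfolded B.scale_mult_left]
        B.scale_mult_left tensor_scale_add)
qed

lemma mult_pure_left:
  "t \<in> tensors \<Longrightarrow> pure a b \<bullet> t = tensor_map sA sB (\<lambda>a'. a * a') (\<lambda>b'. b * b') t"
  unfolding tensor_mult_def by (subst lift_pure[OF bilinear_inner]) (simp_all add: inner_lift)

lemma mult_pure_pure: "pure a b \<bullet> pure a' b' = pure (a * a') (b * b')"
  by (simp add: mult_pure_left pure_in_tensors tensor_map_pure linear_mult_left linear_mult_left')

lemma mult_add_left:
  "t \<in> tensors \<Longrightarrow> t' \<in> tensors \<Longrightarrow> u \<in> tensors \<Longrightarrow> (t + t') \<bullet> u = t \<bullet> u + t' \<bullet> u"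
  by (simp add: tensor_mult_def lift_add[OF bilinear_inner] )

lemma mult_zero_left: "u \<in> tensors \<Longrightarrow> 0 \<bullet> u = 0"
  by (simp add: tensor_mult_def lift_zero[OF bilinear_inner])

lemma mult_add_right:
  assumes "t \<in> tensors" and u: "u \<in> tensors" "u' \<in> tensors"
  shows "t \<bullet> (u + u') = t \<bullet> u + t \<bullet> u'"
  using assms(1)
  by (induction rule: tensors_induct)
    (simp_all add: u mult_zero_left mult_add_left add_in_tensors pure_in_tensors mult_pure_left
      tensor_map_add add_ac)

lemma mult_zero_right: "t \<in> tensors \<Longrightarrow> t \<bullet> 0 = 0"
  using mult_add_right[OF _ zero_in_tensors zero_in_tensors] by simp

lemmas mult_simps = mult_pure_pure mult_add_left mult_zero_left mult_add_right mult_zero_right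

lemma mult_in_tensors:
  assumes "t \<in> tensors" and u: "u \<in> tensors"
  shows "t \<bullet> u \<in> tensors"
  using assms(1)
  by (induction rule: tensors_induct)
    (simp_all add: u mult_simps tensors_closed mult_pure_left tensor_map_in_tensors
        linear_mult_left linear_mult_left')

text \<open>A biadditive identity in two tensors only has to be checked on pure tensors.\<close>

lemma tensors_induct2 [consumes 2, case_names zero_left add_left zero_right add_right pure]:
  assumes "t \<in> tensors" "u \<in> tensors"
    and "\<And>u. u \<in> tensors \<Longrightarrow> P 0 u"
    and "\<And>t t' u. t \<in> tensors \<Longrightarrow> t' \<in> tensors \<Longrightarrow> u \<in> tensors \<Longrightarrow> P t u \<Longrightarrow> P t' u \<Longrightarrow> P (t + t') u"
    and "\<And>t. t \<in> tensors \<Longrightarrow> P t 0"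
    and "\<And>t u u'. t \<in> tensors \<Longrightarrow> u \<in> tensors \<Longrightarrow> u' \<in> tensors \<Longrightarrow> P t u \<Longrightarrow> P t u' \<Longrightarrow> P t (u + u')"
    and "\<And>a b a' b'. P (pure a b) (pure a' b')"
  shows "P t u"
proof -
  have *: "P (pure a b) u" for a b
    using assms(2) by (induction rule: tensors_induct) (auto intro: assms pure_in_tensors)
  from assms(1) show ?thesis
    by (induction rule: tensors_induct) (auto intro: assms * pure_in_tensors)
qed

lemma mult_right_mult_left:
  "t \<in> tensors \<Longrightarrow> u \<in> tensors \<Longrightarrow> right_mult h t \<bullet> u = t \<bullet> left_mult h u"
  by (induction rule: tensors_induct2)
    (simp_all add: mult_simps right_mult_simps left_mult_simps right_mult_in_tensors
      left_mult_in_tensors mult.assoc)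

lemma mult_right_mult_right:
  "t \<in> tensors \<Longrightarrow> u \<in> tensors \<Longrightarrow> t \<bullet> right_mult h u = right_mult h (t \<bullet> u)"
  by (induction rule: tensors_induct2)
    (simp_all add: mult_simps right_mult_simps right_mult_in_tensors mult.assoc)

lemma right_mult_right_mult:
  "t \<in> tensors \<Longrightarrow> right_mult h (right_mult h' t) = right_mult (h' * h) t"
  by (induction rule: tensors_induct)
    (simp_all add: right_mult_simps mult.assoc)

lemma right_mult_zero: "t \<in> tensors \<Longrightarrow> right_mult 0 t = 0"
  by (induction rule: tensors_induct)
    (simp_all add: right_mult_simps pure_zero_right)

lemma right_mult_neg: "t \<in> tensors \<Longrightarrow> right_mult (- h) t = - right_mult h t"
  by (induction rule: tensors_induct)
    (simp_all add: right_mult_simps pure_uminus_right)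

text \<open>
  A functional whose value on products is a sum of products of functionals slices products of
  tensors in the same way.  Two summands suffice for characters and for skew derivations.
\<close>

lemma slice_mult:
  assumes F: "Vector_Spaces.linear sB (*) F" "Vector_Spaces.linear sB (*) F1"
    "Vector_Spaces.linear sB (*) F2" "Vector_Spaces.linear sB (*) F3" "Vector_Spaces.linear sB (*) F4"
    and mult: "\<And>h h'. F (h * h') = F1 h * F2 h' + F3 h * F4 h'"
    and "t \<in> tensors" "u \<in> tensors"
  shows "slice F (t \<bullet> u) = slice F1 t * slice F2 u + slice F3 t * slice F4 u"
  using assms(7,8)
  by (induction rule: tensors_induct2)
    (simp_all add: mult_simps slice_simps F mult_in_tensors mult algebra_simps A.scale_mult_left
      A.scale_mult_right A.scale_left_distrib)

end

section \<open>Idempotents of \<open>E(n)\<close>\<close>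

locale E_algebra = E_hopf_algebra sH \<Delta> \<epsilon> S n g x
  for sH :: "'k::field \<Rightarrow> 'h::{ring,monoid_mult} \<Rightarrow> 'h"
    and \<Delta> :: "'h \<Rightarrow> ('k, 'h, 'h) tensor" and \<epsilon> :: "'h \<Rightarrow> 'k" and S :: "'h \<Rightarrow> 'h"
    and n :: nat and g :: 'h and x :: "nat \<Rightarrow> 'h" +
  assumes two_nonzero: "(2 :: 'k) \<noteq> 0"
begin

sublocale HH: tensor_algebra sH sH ..

lemma k_algebra_H: "k_algebra sH" ..

lemma vector_space_H: "vector_space sH" ..

lemma half_add_half: "sH (1 / 2) h + sH (1 / 2) h = h"
proof -
  have "sH (1 / 2) h + sH (1 / 2) h = sH (1 / 2 + 1 / 2) h" by (rule scale_left_distrib[symmetric])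
  also have "(1 / 2 + 1 / 2 :: 'k) = 1" using two_nonzero by (simp add: field_simps)
  finally show ?thesis by simp
qed

definition e0 :: 'h where "e0 = sH (1 / 2) (1 + g)"

definition e1 :: 'h where "e1 = sH (1 / 2) (1 - g)"

lemma e_add: "e0 + e1 = 1"
  and e_diff: "e0 - e1 = g"
proof -
  have "e0 + e1 = sH (1 / 2) 1 + sH (1 / 2) 1" "e0 - e1 = sH (1 / 2) g + sH (1 / 2) g"
    by (simp_all add: e0_def e1_def scale_right_distrib scale_right_diff_distrib)
  then show "e0 + e1 = 1" "e0 - e1 = g" by (simp_all add: half_add_half)
qed

lemma g_g: "g * g = 1"
  using g_squared by (simp add: power2_eq_square)

lemma x_x_same: "i \<in> {1..n} \<Longrightarrow> x i * x i = 0"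
  using x_squared[of i] by (simp add: power2_eq_square)

lemma e_g: "e0 * g = e0" "e1 * g = - e1" "g * e0 = e0" "g * e1 = - e1"
  by (simp_all add: e0_def e1_def scale_mult_left scale_mult_right algebra_simps g_g
      flip: scale_minus_right)

text \<open>
  Since \<open>g\<close> anticommutes with \<open>x\<^sub>i\<close>, moving \<open>x\<^sub>i\<close> past one idempotent gives the other.  This is
  what makes \<open>\<phi>\<close> appear when \<open>x\<^sub>i\<close> is moved past a coaction.
\<close>

lemma x_e:
  assumes "i \<in> {1..n}"
  shows "x i * e0 = e1 * x i" "x i * e1 = e0 * x i"
  by (simp_all add: e0_def e1_def scale_mult_left scale_mult_right algebra_simps g_x[OF assms])

lemma linear_counit: "Vector_Spaces.linear sH (*) \<epsilon>"
  and counit_mult: "\<epsilon> (h * h') = \<epsilon> h * \<epsilon> h'"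
  and counit_one: "\<epsilon> 1 = 1"
  using algebra_map_counit by (simp_all add: algebra_map_def)

lemma counit_e: "\<epsilon> e0 = 1" "\<epsilon> e1 = 0"
  using two_nonzero
  by (simp_all add: e0_def e1_def linearD[OF linear_counit] counit_one counit_g)

text \<open>
  The idempotents \<open>e\<^sub>0\<close> and \<open>e\<^sub>1\<close> comultiply like the indicator functions of the two elements of
  \<open>\<int>/2\<close>.
\<close>

lemma comult_e:
  "\<Delta> e0 = HH.pure e0 e0 + HH.pure e1 e1" "\<Delta> e1 = HH.pure e0 e1 + HH.pure e1 e0"
proof -
  interpret T: vector_space "tensor_scale :: 'k \<Rightarrow> ('k, 'h, 'h) tensor \<Rightarrow> _"
    by (rule vector_space_tensor_scale)
  note D = linearD[OF linear_coaction]
  have half: "tensor_scale (1 / 2) (t + t) = t" for t :: "('k, 'h, 'h) tensor"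
  proof -
    have "tensor_scale (1 / 2) (t + t) = tensor_scale (1 / 2 + 1 / 2) t"
      unfolding tensor_scale_add by (rule T.scale_left_distrib[symmetric])
    also have "(1 / 2 + 1 / 2 :: 'k) = 1" using two_nonzero by (simp add: field_simps)
    finally show ?thesis by (simp only: T.scale_one)
  qed
  let ?s = "HH.pure e0 e0 + HH.pure e1 e1" and ?d = "HH.pure e0 e1 + HH.pure e1 e0"
  have 1: "\<Delta> 1 = ?s + ?d"
    unfolding comult_one unfolding e_add[symmetric] by (simp add: HH.pure_add_left HH.pure_add_right)
  have g: "\<Delta> g = ?s - ?d"
  proof -
    have "HH.pure (e0 - e1) (e0 - e1) = ?s - ?d"
      by (simp add: HH.pure_diff_left HH.pure_diff_right)
    then show ?thesis by (simp only: e_diff comult_g)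
  qed
  have "\<Delta> e0 = tensor_scale (1 / 2) (?s + ?s)"
    unfolding e0_def D(1,2) 1 g by simp
  also have "\<dots> = ?s" by (rule half)
  finally show "\<Delta> e0 = ?s" .
  have "\<Delta> e1 = tensor_scale (1 / 2) (?d + ?d)"
    unfolding e1_def D(2,5) 1 g by simp
  also have "\<dots> = ?d" by (rule half)
  finally show "\<Delta> e1 = ?d" .
qed

end

section \<open>Comodule algebras from skew derivations\<close>

locale E_coaction = E_algebra sH \<Delta> \<epsilon> S n g x + A: k_algebra sA
  for sH :: "'k::field \<Rightarrow> 'h::{ring,monoid_mult} \<Rightarrow> 'h"
    and \<Delta> :: "'h \<Rightarrow> ('k, 'h, 'h) tensor" and \<epsilon> :: "'h \<Rightarrow> 'k" and S :: "'h \<Rightarrow> 'h"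
    and n :: nat and g :: 'h and x :: "nat \<Rightarrow> 'h"
    and sA :: "'k \<Rightarrow> 'a::{ring,monoid_mult} \<Rightarrow> 'a"
begin

sublocale AH: tensor_algebra sA sH ..

sublocale AHH: tensor_product "tensor_scale :: 'k \<Rightarrow> ('k, 'a, 'h) tensor \<Rightarrow> _" sH
  by (intro tensor_product.intro vector_space_tensor_scale vector_space_H)

text \<open>
  This is \<open>id \<otimes> \<Delta>\<close>, followed by the identification of \<open>A \<otimes> (H \<otimes> H)\<close> with
  \<open>(A \<otimes> H) \<otimes> H\<close>: the right-hand side of the coassociativity axiom.
\<close>

definition comult_right :: "('k, 'a, 'h) tensor \<Rightarrow> ('k, ('k, 'a, 'h) tensor, 'h) tensor" where
  "comult_right = tensor_lift sA sH
     (\<lambda>a h. tensor_lift sH sH (\<lambda>h1 h2. AHH.pure (AH.pure a h1) h2) (\<Delta> h))"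

abbreviation pure_left :: "'a \<Rightarrow> ('k, 'h, 'h) tensor \<Rightarrow> ('k, ('k, 'a, 'h) tensor, 'h) tensor" where
  "pure_left a \<equiv> tensor_map tensor_scale sH (AH.pure a) (\<lambda>h. h)"

lemma inner_comult:
  "u \<in> HH.tensors \<Longrightarrow>
    tensor_lift sH sH (\<lambda>h1 h2. AHH.pure (AH.pure a h1) h2) u = pure_left a u"
  by (intro HH.lift_eq_tensor_map AH.linear_pure_right linear_id_map vector_space_H)

lemmas pure_left_simps =
  tensor_map_zero tensor_map_add tensor_map_pure[OF AH.linear_pure_right linear_id_map[OF vector_space_H]]

lemma pure_left_linear:
  assumes "u \<in> HH.tensors"
  shows "pure_left (a + a') u = pure_left a u + pure_left a' u"
    and "pure_left (sA c a) u = tensor_scale c (pure_left a u)"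
proof -
  have add: "Vector_Spaces.linear sH tensor_scale (\<lambda>h. AH.pure a h + AH.pure a' h)"
    by (intro linearI vector_space_H vector_space_tensor_scale)
      (simp_all add: AH.pure_add_right AH.pure_scale_right tensor_scale_add)
  have scale: "Vector_Spaces.linear sH tensor_scale (\<lambda>h. tensor_scale c (AH.pure a h))"
    by (intro linearI vector_space_H vector_space_tensor_scale)
      (simp_all add: AH.pure_add_right AH.pure_scale_right tensor_scale_add tensor_scale_commute[of c])
  show "pure_left (a + a') u = pure_left a u + pure_left a' u"
    using assms by (induction rule: HH.tensors_induct)
      (simp_all add: pure_left_simps AH.pure_add_left
        tensor_map_pure[OF add linear_id_map[OF vector_space_H]] AHH.pure_add_left)
  show "pure_left (sA c a) u = tensor_scale c (pure_left a u)"
    using assms by (induction rule: HH.tensors_induct)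
      (simp_all add: pure_left_simps AH.pure_scale_left
        tensor_map_pure[OF scale linear_id_map[OF vector_space_H]] AHH.pure_scale_left tensor_scale_add)
qed

lemma comult_right_eq: "comult_right = tensor_lift sA sH (\<lambda>a h. pure_left a (\<Delta> h))"
  unfolding comult_right_def inner_comult[OF coaction_in_tensor_space] ..

lemma bilinear_comult_right: "bilinear_map sA sH tensor_scale (\<lambda>a h. pure_left a (\<Delta> h))"
  by (intro bilinear_mapI A.vector_space_axioms vector_space_H vector_space_tensor_scale)
    (simp_all add: pure_left_linear[OF coaction_in_tensor_space] linearD[OF linear_coaction]
      tensor_map_add tensor_map_scale)

lemma comult_right_simps:
  "comult_right (AH.pure a h) = pure_left a (\<Delta> h)"
  "comult_right 0 = 0"
  "t \<in> AH.tensors \<Longrightarrow> t' \<in> AH.tensors \<Longrightarrow> comult_right (t + t') = comult_right t + comult_right t'"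
  unfolding comult_right_eq
  by (simp_all only: AH.lift_pure[OF bilinear_comult_right] AH.lift_zero[OF bilinear_comult_right]
      AH.lift_add[OF bilinear_comult_right])

text \<open>
  Right multiplication by \<open>1 \<otimes> h1 \<otimes> h2\<close> on \<open>(A \<otimes> H) \<otimes> H\<close>.
\<close>

definition right_mult2 ::
  "'h \<Rightarrow> 'h \<Rightarrow> ('k, ('k, 'a, 'h) tensor, 'h) tensor \<Rightarrow> ('k, ('k, 'a, 'h) tensor, 'h) tensor" where
  "right_mult2 h1 h2 = tensor_map tensor_scale sH (AH.right_mult h1) (\<lambda>h. h * h2)"

lemma right_mult2_simps:
  "right_mult2 h1 h2 (AHH.pure t h) = AHH.pure (AH.right_mult h1 t) (h * h2)"
  "right_mult2 h1 h2 0 = 0"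
  "right_mult2 h1 h2 (u + u') = right_mult2 h1 h2 u + right_mult2 h1 h2 u'"
  by (simp_all add: right_mult2_def tensor_map_zero tensor_map_add
      tensor_map_pure[OF _ HH.linear_mult_right] AH.right_mult_def linear_tensor_map)

text \<open>
  Multiplicativity of \<open>\<Delta>\<close> turns right multiplication by \<open>x\<^sub>i\<close> into right multiplication by
  \<open>\<Delta>(x\<^sub>i) = x\<^sub>i \<otimes> g + 1 \<otimes> x\<^sub>i\<close>.
\<close>

lemma comult_right_right_mult:
  assumes t: "t \<in> AH.tensors" and i: "i \<in> {1..n}"
  shows "comult_right (AH.right_mult (x i) t) =
    right_mult2 (x i) g (comult_right t) + right_mult2 1 (x i) (comult_right t)"
proof -
  have *: "pure_left a (tensor_mult sH sH u (HH.pure p q)) = right_mult2 p q (pure_left a u)"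
    if "u \<in> HH.tensors" for a u p q
    using that by (induction rule: HH.tensors_induct)
      (simp_all add: pure_left_simps right_mult2_simps HH.mult_simps HH.pure_in_tensors
        AH.right_mult_simps)
  have comult: "pure_left a (\<Delta> (h * x i)) =
      right_mult2 (x i) g (pure_left a (\<Delta> h)) + right_mult2 1 (x i) (pure_left a (\<Delta> h))" for a h
    by (simp add: comult_mult comult_x[OF i] HH.mult_simps coaction_in_tensor_space
        HH.pure_in_tensors pure_left_simps *)
  from t show ?thesis
    by (induction rule: AH.tensors_induct)
      (simp_all add: comult comult_right_simps right_mult2_simps AH.right_mult_simps add_ac
        AH.pure_in_tensors AH.right_mult_in_tensors)
qed

end

text \<open>
  The operators \<open>E i\<close> stand for \<open>d\<^sub>i \<phi>\<close>.  Composing a \<open>\<phi>\<close>-derivation with the involution \<open>\<phi>\<close> moves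
  the twist to the right-hand factor, and the relations \<open>\<phi> d\<^sub>i = - d\<^sub>i \<phi>\<close> and
  \<open>d\<^sub>i d\<^sub>j = - d\<^sub>j d\<^sub>i\<close> carry over unchanged.
\<close>

locale odd_derivations = E_coaction sH \<Delta> \<epsilon> S n g x sA
  for sH :: "'k::field \<Rightarrow> 'h::{ring,monoid_mult} \<Rightarrow> 'h"
    and \<Delta> :: "'h \<Rightarrow> ('k, 'h, 'h) tensor" and \<epsilon> :: "'h \<Rightarrow> 'k" and S :: "'h \<Rightarrow> 'h"
    and n :: nat and g :: 'h and x :: "nat \<Rightarrow> 'h"
    and sA :: "'k \<Rightarrow> 'a::{ring,monoid_mult} \<Rightarrow> 'a" +
  fixes \<phi> :: "'a \<Rightarrow> 'a" and E :: "nat \<Rightarrow> 'a \<Rightarrow> 'a"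
  assumes linear_phi: "Vector_Spaces.linear sA sA \<phi>"
    and phi_mult: "\<phi> (a * b) = \<phi> a * \<phi> b"
    and phi_one: "\<phi> 1 = 1"
    and phi_phi: "\<phi> (\<phi> a) = a"
    and linear_E: "i \<in> {1..n} \<Longrightarrow> Vector_Spaces.linear sA sA (E i)"
    and E_mult: "i \<in> {1..n} \<Longrightarrow> E i (a * b) = E i a * \<phi> b + a * E i b"
    and phi_E: "i \<in> {1..n} \<Longrightarrow> \<phi> (E i a) = - E i (\<phi> a)"
    and E_E: "i \<in> {1..n} \<Longrightarrow> j \<in> {1..n} \<Longrightarrow> E i (E j a) = - E j (E i a)"
begin

lemma E_one: "i \<in> {1..n} \<Longrightarrow> E i 1 = 0"
  using E_mult[of i 1 1] by (simp add: phi_one)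

lemma E_E_same:
  assumes "i \<in> {1..n}"
  shows "E i (E i a) = 0"
proof -
  have "sA 2 (E i (E i a)) = sA (1 + 1) (E i (E i a))" by simp
  also have "\<dots> = E i (E i a) + E i (E i a)" unfolding A.scale_left_distrib by simp
  also have "\<dots> = 0" using E_E[OF assms assms, of a] by (simp only: eq_neg_iff_add_eq_0)
  finally show ?thesis using two_nonzero by simp
qed

text \<open>
  The product \<open>(1 \<otimes> e\<^sub>0 + \<phi> \<otimes> e\<^sub>1) (1 + E\<^sub>1 \<otimes> x\<^sub>1) \<cdots> (1 + E\<^sub>k \<otimes> x\<^sub>k)\<close> applied to \<open>a \<otimes> 1\<close>.  The
  last factor acts first, so \<open>E\<^sub>k\<close> reaches \<open>a\<close> directly and \<open>x\<^sub>k\<close> ends up on the far right.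
\<close>

primrec coact :: "nat \<Rightarrow> 'a \<Rightarrow> ('k, 'a, 'h) tensor" where
  "coact 0 a = AH.pure a e0 + AH.pure (\<phi> a) e1"
| "coact (Suc k) a = coact k a + AH.right_mult (x (Suc k)) (coact k (E (Suc k) a))"

lemma coact_in_tensors: "coact k a \<in> AH.tensors"
  by (induction k arbitrary: a)
    (simp_all add: AH.tensors_closed AH.right_mult_in_tensors)

lemma linear_coact: "k \<le> n \<Longrightarrow> Vector_Spaces.linear sA tensor_scale (coact k)"
proof (induction k)
  case 0
  show ?case
    by (intro linearI A.vector_space_axioms vector_space_tensor_scale)
      (simp_all add: linearD[OF linear_phi] AH.pure_add_left AH.pure_scale_left
        tensor_scale_add)
next
  case (Suc k)
  then have "Vector_Spaces.linear sA tensor_scale (coact k)"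
    and "Vector_Spaces.linear sA sA (E (Suc k))"
    by (auto intro: linear_E)
  note lin = linearD[OF this(1)] linearD[OF this(2)]
  show ?case
    by (intro linearI A.vector_space_axioms vector_space_tensor_scale)
      (simp_all add: lin AH.right_mult_simps tensor_scale_add)
qed

lemma left_mult_right_mult:
  "t \<in> AH.tensors \<Longrightarrow>
    AH.left_mult h (AH.right_mult h' t) = AH.right_mult h' (AH.left_mult h t)"
  by (induction rule: AH.tensors_induct)
    (simp_all add: AH.right_mult_simps AH.left_mult_simps mult.assoc)

text \<open>
  For \<open>k = 0\<close>, moving \<open>x\<^sub>i\<close> to the right swaps \<open>e\<^sub>0\<close> and \<open>e\<^sub>1\<close>, which amounts to replacing \<open>b\<close> by
  \<open>\<phi> b\<close>.  In the induction step the sign of \<open>x\<^sub>i x\<^bsub>k+1\<^esub> = - x\<^bsub>k+1\<^esub> x\<^sub>i\<close> cancels that of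
  \<open>\<phi> E\<^bsub>k+1\<^esub> = - E\<^bsub>k+1\<^esub> \<phi>\<close>.  The case
  \<open>i = k + 1\<close> is the one that multiplicativity needs.
\<close>

lemma left_mult_x_coact:
  assumes "k \<le> n" and i: "i \<in> {1..n}"
  shows "AH.left_mult (x i) (coact k b) = AH.right_mult (x i) (coact k (\<phi> b))"
  using assms(1)
proof (induction k arbitrary: b)
  case 0
  then show ?case
    by (simp add: AH.left_mult_simps AH.right_mult_simps x_e[OF i] phi_phi add_ac)
next
  case (Suc k)
  let ?y = "x (Suc k)" and ?E = "E (Suc k)"
  from Suc.prems have k: "k \<le> n" "Suc k \<in> {1..n}" by auto
  note IH = Suc.IH[OF k(1)] and lin = linearD[OF linear_coact[OF k(1)]]
  have "AH.left_mult (x i) (AH.right_mult ?y (coact k (?E b))) =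
      AH.right_mult ?y (AH.right_mult (x i) (coact k (\<phi> (?E b))))"
    by (simp add: left_mult_right_mult coact_in_tensors IH)
  also have "\<dots> = AH.right_mult (x i) (AH.right_mult ?y (coact k (?E (\<phi> b))))"
    by (simp add: phi_E[OF k(2)] lin AH.right_mult_simps AH.right_mult_right_mult coact_in_tensors
        x_x[OF i k(2)] AH.right_mult_neg)
  finally show ?case
    by (simp add: AH.left_mult_simps AH.right_mult_simps IH)
qed

text \<open>
  Put \<open>\<rho> = coact k\<close>, \<open>x = x\<^bsub>k+1\<^esub>\<close> and \<open>E = E\<^bsub>k+1\<^esub>\<close>.  In the product of \<open>\<rho>(a) + \<rho>(E a) x\<close> and
  \<open>\<rho>(b) + \<rho>(E b) x\<close>, moving \<open>x\<close> to the right with the preceding lemma gives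
  \<open>\<rho>(a) \<rho>(b) + (\<rho>(a) \<rho>(E b) + \<rho>(E a) \<rho>(\<phi> b)) x\<close>, because \<open>x\<^sup>2 = 0\<close>; the bracket is \<open>\<rho>(E(ab))\<close>.
\<close>

lemma coact_mult: "k \<le> n \<Longrightarrow> coact k (a * b) = tensor_mult sA sH (coact k a) (coact k b)"
proof (induction k arbitrary: a b)
  have e: "e0 * e0 = e0" "e1 * e1 = e1" "e0 * e1 = 0" "e1 * e0 = 0"
  proof -
    show "e0 * e0 = e0"
      using e_g(1) half_add_half[of e0]
      by (simp add: e0_def scale_mult_right distrib_left scale_right_distrib)
    show "e1 * e1 = e1"
      using e_g(2) half_add_half[of e1]
      by (simp add: e1_def scale_mult_right right_diff_distrib scale_right_distrib)
    show "e0 * e1 = 0"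
      using e_g(1) by (simp add: e1_def scale_mult_right right_diff_distrib)
    show "e1 * e0 = 0"
      using e_g(2) by (simp add: e0_def scale_mult_right distrib_left)
  qed
  case 0
  then show ?case
    by (simp add: AH.mult_simps AH.tensors_closed phi_mult e AH.pure_zero_right)
next
  case (Suc k)
  let ?y = "x (Suc k)" and ?E = "E (Suc k)"
  from Suc.prems have k: "k \<le> n" "Suc k \<in> {1..n}" by auto
  note IH = Suc.IH[OF k(1)] and lin = linearD[OF linear_coact[OF k(1)]]
  have square: "AH.right_mult ?y (AH.right_mult ?y t) = 0" if "t \<in> AH.tensors" for t
    using that by (simp add: AH.right_mult_right_mult x_x_same[OF k(2)] AH.right_mult_zero)
  show ?case
    by (simp add: E_mult[OF k(2)] lin IH AH.right_mult_simps AH.mult_simps AH.add_in_tensors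
        coact_in_tensors AH.right_mult_in_tensors AH.mult_right_mult_right AH.mult_right_mult_left
        left_mult_x_coact[OF k] square AH.mult_in_tensors add_ac)
qed

lemma coact_one: "k \<le> n \<Longrightarrow> coact k 1 = AH.pure 1 1"
proof (induction k)
  case 0
  show ?case by (simp add: phi_one flip: AH.pure_add_right) (simp add: e_add)
next
  case (Suc k)
  then show ?case
    by (simp add: E_one linearD[OF linear_coact] AH.right_mult_simps)
qed

lemma counit_coact: "k \<le> n \<Longrightarrow> AH.slice \<epsilon> (coact k a) = a"
proof (induction k arbitrary: a)
  case 0
  show ?case by (simp add: AH.slice_simps[OF linear_counit] AH.pure_in_tensors counit_e)
next
  case (Suc k)
  then have k: "Suc k \<in> {1..n}" by simp
  have "AH.slice \<epsilon> (AH.right_mult (x (Suc k)) t) = 0" if "t \<in> AH.tensors" for t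
    using that by (induction rule: AH.tensors_induct)
      (simp_all add: AH.right_mult_simps AH.slice_simps[OF linear_counit] AH.tensors_closed
        AH.right_mult_in_tensors counit_mult counit_x[OF k])
  with Suc show ?case
    by (simp add: AH.slice_simps[OF linear_counit] coact_in_tensors AH.right_mult_in_tensors)
qed

text \<open>
  For \<open>k = 0\<close> both sides are \<open>E\<^sub>i(a) \<otimes> e\<^sub>0 - \<phi>(E\<^sub>i a) \<otimes> e\<^sub>1\<close>, since \<open>E\<^sub>i \<phi> = - \<phi> E\<^sub>i\<close> and \<open>e\<^sub>1 g = - e\<^sub>1\<close>.
  In the induction step the sign from \<open>E\<^sub>i E\<^bsub>k+1\<^esub> = - E\<^bsub>k+1\<^esub> E\<^sub>i\<close> is that of \<open>g x\<^bsub>k+1\<^esub> = - x\<^bsub>k+1\<^esub> g\<close>.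
\<close>

lemma E_left_coact:
  assumes "k \<le> n" and i: "i \<in> {1..n}"
  shows "tensor_map sA sH (E i) (\<lambda>h. h) (coact k a) = AH.right_mult g (coact k (E i a))"
  using assms(1)
proof (induction k arbitrary: a)
  note map_pure = tensor_map_pure[OF linear_E[OF i] linear_id_map[OF vector_space_H]]
  case 0
  show ?case
    by (simp add: tensor_map_add map_pure AH.right_mult_simps e_g phi_E[OF i]
        AH.pure_uminus_right AH.pure_uminus_left)
next
  note map_pure = tensor_map_pure[OF linear_E[OF i] linear_id_map[OF vector_space_H]]
  case (Suc k)
  let ?y = "x (Suc k)" and ?E = "E (Suc k)"
  from Suc.prems have k: "k \<le> n" "Suc k \<in> {1..n}" by auto
  note IH = Suc.IH[OF k(1)] and lin = linearD[OF linear_coact[OF k(1)]]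
  have "tensor_map sA sH (E i) (\<lambda>h. h) (AH.right_mult h t) =
      AH.right_mult h (tensor_map sA sH (E i) (\<lambda>h. h) t)" if "t \<in> AH.tensors" for h t
    using that by (induction rule: AH.tensors_induct)
      (simp_all add: AH.right_mult_simps tensor_map_zero tensor_map_add map_pure)
  then show ?case
    by (simp add: tensor_map_add IH coact_in_tensors AH.right_mult_simps AH.right_mult_right_mult
        E_E[OF i k(2)] lin g_x[OF k(2)] AH.right_mult_neg)
qed

text \<open>
  Put \<open>\<rho> = coact k\<close>, \<open>x = x\<^bsub>k+1\<^esub>\<close> and \<open>E = E\<^bsub>k+1\<^esub>\<close>.  Expanding both occurrences of \<open>coact (k + 1)\<close> on
  the left gives four terms.  The terms \<open>(\<rho> \<otimes> id) \<rho>(a)\<close> and \<open>(\<rho> \<otimes> id) \<rho>(E a)\<close> times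
  \<open>1 \<otimes> 1 \<otimes> x\<close> are as they should be.  By \<open>E_left_coact\<close> the third one is \<open>(\<rho> \<otimes> id) \<rho>(E a)\<close> times
  \<open>1 \<otimes> x \<otimes> g\<close>, the other half of \<open>\<Delta>(x)\<close>, and the fourth one contains \<open>E (E a) = 0\<close>.
\<close>

lemma coact_coassoc:
  "k \<le> n \<Longrightarrow> tensor_map tensor_scale sH (coact k) (\<lambda>h. h) (coact k a) = comult_right (coact k a)"
proof (induction k arbitrary: a)
  case 0
  note map_pure = tensor_map_pure[OF linear_coact[OF 0] linear_id_map[OF vector_space_H]]
  show ?case
    by (simp add: tensor_map_add map_pure[unfolded coact.simps] comult_right_simps
        AH.pure_in_tensors comult_e
        pure_left_simps AHH.pure_add_left phi_phi add_ac)
next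
  case (Suc k)
  let ?y = "x (Suc k)" and ?E = "E (Suc k)"
  from Suc.prems have k: "k \<le> n" "Suc k \<in> {1..n}" by auto
  let ?M = "\<lambda>f. tensor_map tensor_scale sH f (\<lambda>h. h)"
  let ?N = "tensor_map sA sH ?E (\<lambda>h. h)"
  note IH = Suc.IH[OF k(1)]
  note lin = linear_coact[OF k(1)] linear_coact[OF Suc.prems]
  note ident = linear_id_map[OF vector_space_H]
  note map_pure = tensor_map_pure[OF lin(1) ident] tensor_map_pure[OF lin(2) ident]
    tensor_map_pure[OF linear_E[OF k(2)] ident]
  have N_in: "?N t \<in> AH.tensors" if "t \<in> AH.tensors" for t
    by (intro AH.tensor_map_in_tensors linear_E k ident that)
  have step: "?M (coact (Suc k)) t = ?M (coact k) t + right_mult2 ?y 1 (?M (coact k) (?N t))"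
    if "t \<in> AH.tensors" for t
    using that by (induction rule: AH.tensors_induct)
      (simp_all add: tensor_map_zero tensor_map_add map_pure(1,3) map_pure(2)[unfolded coact.simps]
        right_mult2_simps AHH.pure_add_left
        AHH.pure_add_right add_ac)
  have M_right_mult: "right_mult2 h' 1 (?M (coact k) (AH.right_mult h t)) =
      right_mult2 h' h (?M (coact k) t)" if "t \<in> AH.tensors" for t h h'
    using that by (induction rule: AH.tensors_induct)
      (simp_all add: tensor_map_zero tensor_map_add map_pure right_mult2_simps AH.right_mult_simps)
  have one: "AH.right_mult 1 t = t" if "t \<in> AH.tensors" for t
    using that by (induction rule: AH.tensors_induct) (simp_all add: AH.right_mult_simps)
  have M_right_mult': "?M (coact k) (AH.right_mult h t) = right_mult2 1 h (?M (coact k) t)"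
    if "t \<in> AH.tensors" for t h
    using that by (induction rule: AH.tensors_induct)
      (simp_all add: tensor_map_zero tensor_map_add map_pure right_mult2_simps AH.right_mult_simps
        one coact_in_tensors)
  have N_right_mult: "?N (AH.right_mult h t) = AH.right_mult h (?N t)" if "t \<in> AH.tensors" for h t
    using that by (induction rule: AH.tensors_induct)
      (simp_all add: AH.right_mult_simps tensor_map_zero tensor_map_add map_pure)
  have "?M (coact (Suc k)) (coact (Suc k) a) =
      ?M (coact k) (coact k a) + right_mult2 1 ?y (?M (coact k) (coact k (?E a))) +
      right_mult2 ?y g (?M (coact k) (coact k (?E a)))"
    by (simp add: step AH.add_in_tensors AH.right_mult_in_tensors coact_in_tensors
        tensor_map_add[of _ _ "coact k"] tensor_map_add[of _ _ ?E]
        N_right_mult E_left_coact[OF k] E_E_same[OF k(2)] linearD[OF lin(1)]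
        M_right_mult M_right_mult'[of _ ?y] AH.right_mult_simps tensor_map_zero right_mult2_simps
        del: coact.simps(2) add: coact.simps(2)[of k a] add_ac)
  also have "\<dots> = comult_right (coact (Suc k) a)"
    by (simp add: IH comult_right_simps coact_in_tensors AH.right_mult_in_tensors
        comult_right_right_mult[OF _ k(2)] add_ac)
  finally show ?case .
qed

theorem coact_comodule_algebra: "right_comodule_algebra sA sH \<Delta> \<epsilon> (coact n)"
proof unfold_locales
  show "coact n (a + b) = coact n a + coact n b" "coact n (sA c a) = tensor_scale c (coact n a)"
    for a b c by (simp_all add: linearD[OF linear_coact])
  show "tensor_lift sA sH (\<lambda>a h. sA (\<epsilon> h) a) (coact n a) = a" for a
    using counit_coact[of n a] by (simp add: AH.slice_def)
  show "coact n a \<in> AH.tensors" for a by (rule coact_in_tensors)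
  show "coact n (a * b) = tensor_mult sA sH (coact n a) (coact n b)" for a b
    by (rule coact_mult) simp
  show "coact n 1 = AH.pure 1 1" by (rule coact_one) simp
  show "tensor_lift sA sH (\<lambda>a h. AHH.pure (coact n a) h) (coact n a) =
      tensor_lift sA sH
        (\<lambda>a h. tensor_lift sH sH (\<lambda>h1 h2. AHH.pure (AH.pure a h1) h2) (\<Delta> h)) (coact n a)" for a
    using coact_coassoc[of n a]
    by (simp add: AH.lift_eq_tensor_map linear_coact linear_id_map vector_space_H coact_in_tensors
        comult_right_def)
qed

end

section \<open>Monomials and functionals on \<open>E(n)\<close>\<close>

lemma sorted_list_of_set_insert_min:
  assumes "finite P" "\<And>p. p \<in> P \<Longrightarrow> i < p"
  shows "sorted_list_of_set (insert i P) = i # sorted_list_of_set P"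
proof (rule sorted_distinct_set_unique)
  have "i \<notin> P" using assms(2) by blast
  with assms show "sorted (i # sorted_list_of_set P)" "distinct (i # sorted_list_of_set P)"
    by (auto simp: less_imp_le)
qed (use assms(1) in \<open>simp_all only: set_sorted_list_of_set finite_insert list.set set_append
  sorted_sorted_list_of_set distinct_sorted_list_of_set Un_insert_right Un_empty_right\<close>)

lemma sorted_list_of_set_insert_max:
  assumes "finite P" "\<And>p. p \<in> P \<Longrightarrow> p < i"
  shows "sorted_list_of_set (insert i P) = sorted_list_of_set P @ [i]"
proof (rule sorted_distinct_set_unique)
  have "i \<notin> P" using assms(2) by blast
  with assms show "sorted (sorted_list_of_set P @ [i])" "distinct (sorted_list_of_set P @ [i])"
    by (auto simp: sorted_append less_imp_le)
qed (use assms(1) in \<open>simp_all only: set_sorted_list_of_set finite_insert list.set set_append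
  sorted_sorted_list_of_set distinct_sorted_list_of_set Un_insert_right Un_empty_right\<close>)

lemma ordered_prod_empty: "ordered_prod y {} = 1"
  and ordered_prod_insert_min:
    "finite P \<Longrightarrow> (\<And>p. p \<in> P \<Longrightarrow> i < p) \<Longrightarrow> ordered_prod y (insert i P) = y i * ordered_prod y P"
  and ordered_prod_insert_max:
    "finite P \<Longrightarrow> (\<And>p. p \<in> P \<Longrightarrow> p < i) \<Longrightarrow> ordered_prod y (insert i P) = ordered_prod y P * y i"
  by (simp_all add: ordered_prod_def sorted_list_of_set_insert_min sorted_list_of_set_insert_max
      del: sorted_list_of_set_insert_remove)

lemma ordered_prod_singleton: "ordered_prod y {i} = y i"
  by (simp add: ordered_prod_def)

lemma finite_subset_interval: "P \<subseteq> {1..n::nat} \<Longrightarrow> finite P"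
  by (rule finite_subset) auto

context E_algebra
begin

text \<open>
  Move \<open>x\<^sub>i\<close> to the right, past the factors with smaller index, until it reaches its place or meets
  another \<open>x\<^sub>i\<close>.
\<close>

lemma x_ordered_prod:
  assumes "finite P" "P \<subseteq> {1..n}" "i \<in> {1..n}"
  shows "if i \<in> P then x i * ordered_prod x P = 0
    else x i * ordered_prod x P \<in> {ordered_prod x (insert i P), - ordered_prod x (insert i P)}"
  using assms(1,2)
proof (induction P rule: finite_linorder_min_induct)
  case empty
  show ?case by (simp add: ordered_prod_empty ordered_prod_singleton)
next
  case (insert m P)
  have m: "m \<in> {1..n}" and P: "P \<subseteq> {1..n}" using insert.prems by auto
  have prod: "ordered_prod x (insert m P) = x m * ordered_prod x P"
    using insert.hyps by (intro ordered_prod_insert_min) auto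
  consider "i = m" | "i < m" | "m < i" by linarith
  then show ?case
  proof cases
    case 1
    have "x m * (x m * ordered_prod x P) = 0"
      by (simp add: x_x_same[OF m] flip: mult.assoc)
    with 1 show ?thesis by (simp add: prod)
  next
    case 2
    then have "ordered_prod x (insert i (insert m P)) = x i * ordered_prod x (insert m P)"
      using insert.hyps by (intro ordered_prod_insert_min) auto
    moreover have "i \<notin> insert m P" using 2 insert.hyps by auto
    ultimately show ?thesis by simp
  next
    case 3
    have "insert i (insert m P) = insert m (insert i P)" by blast
    then have prod': "ordered_prod x (insert i (insert m P)) = x m * ordered_prod x (insert i P)"
      using insert.hyps 3 by (auto intro: ordered_prod_insert_min)
    have "x i * ordered_prod x (insert m P) = - (x m * (x i * ordered_prod x P))"
      unfolding prod by (simp add: x_x[OF assms(3) m] flip: mult.assoc)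
    with insert.IH[OF P] 3 show ?thesis
      by (cases "i \<in> P") (auto simp: prod')
  qed
qed

definition monomial :: "bool \<Rightarrow> nat set \<Rightarrow> 'h" where
  "monomial j P = (if j then g else 1) * ordered_prod x P"

lemma monomial_eqs:
  "monomial False {} = 1" "monomial True {} = g" "monomial False {i} = x i"
  "g * monomial j P = monomial (\<not> j) P"
  by (simp_all add: monomial_def ordered_prod_empty ordered_prod_singleton g_g flip: mult.assoc)

lemma x_monomial:
  assumes P: "P \<subseteq> {1..n}" and i: "i \<in> {1..n}"
  shows "i \<in> P \<Longrightarrow> x i * monomial j P = 0"
    and "i \<notin> P \<Longrightarrow> x i * monomial j P \<in> {monomial j (insert i P), - monomial j (insert i P)}"
proof -
  have x_g: "x i * (g * h) = - (g * (x i * h))" for h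
    by (simp add: g_x[OF i] flip: mult.assoc)
  have *: "x i * monomial j P = (if j then - (g * (x i * ordered_prod x P)) else x i * ordered_prod x P)"
    by (simp add: monomial_def x_g)
  show "i \<in> P \<Longrightarrow> x i * monomial j P = 0"
    and "i \<notin> P \<Longrightarrow> x i * monomial j P \<in> {monomial j (insert i P), - monomial j (insert i P)}"
    using x_ordered_prod[OF finite_subset_interval[OF P] P i]
    unfolding * by (auto simp: monomial_def split: if_splits)
qed

lemma generated_induct [case_names one g x add scale mult]:
  assumes "P 1" "P g" "\<And>i. i \<in> {1..n} \<Longrightarrow> P (x i)"
    and "\<And>h h'. P h \<Longrightarrow> P h' \<Longrightarrow> P (h + h')" "\<And>c h. P h \<Longrightarrow> P (sH c h)"
    and "\<And>h h'. P h \<Longrightarrow> P h' \<Longrightarrow> P (h * h')"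
  shows "P h"
proof -
  have "P 0" using assms(5)[of 1 0] assms(1) by simp
  then have "subalgebra sH (Collect P)"
    using assms by (auto simp: subalgebra_def subspace_def)
  moreover have "{g} \<union> x ` {1..n} \<subseteq> Collect P" using assms by auto
  ultimately have "Collect P = UNIV" using generated unfolding generated_by_def by blast
  then show ?thesis by blast
qed

abbreviation "indices \<equiv> (UNIV :: bool set) \<times> Pow {1..n}"

text \<open>
  The span of the monomials is stable under left multiplication by the generators, hence a left
  ideal, and it contains \<open>1\<close>.
\<close>

lemma span_monomials: "span (case_prod monomial ` indices) = UNIV" (is "span ?B = _")
proof -
  have closed: "h * b \<in> span ?B" if "\<And>b. b \<in> ?B \<Longrightarrow> h * b \<in> span ?B" and "b \<in> span ?B" for h b
    using that(2)
  proof (induction rule: span_induct_alt)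
    case base
    show ?case by (simp add: span_zero)
  next
    case (step c b b')
    then show ?case
      by (simp add: distrib_left scale_mult_right span_add span_scale that(1))
  qed
  have left_ideal: "\<forall>b\<in>span ?B. h * b \<in> span ?B" for h
  proof (induction h rule: generated_induct)
    case g
    have "g * b \<in> span ?B" if "b \<in> ?B" for b
    proof -
      from that obtain j P where "b = monomial j P" "(\<not> j, P) \<in> indices" by auto
      then show ?thesis by (intro span_base) (force simp: monomial_eqs)
    qed
    then show ?case using closed by blast
  next
    case (x i)
    have "x i * b \<in> span ?B" if b: "b \<in> ?B" for b
    proof -
      from b obtain j P where b: "b = monomial j P" and P: "P \<subseteq> {1..n}" by auto
      have "monomial j (insert i P) \<in> span ?B" using P x by (intro span_base) force
      then show ?thesis
        using x_monomial[OF P x, of j] by (cases "i \<in> P") (auto simp: b span_zero span_neg)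
    qed
    then show ?case using closed by blast
  next
    case (add h h')
    then show ?case by (simp add: distrib_right span_add)
  next
    case (scale c h)
    then show ?case by (simp add: scale_mult_left span_scale)
  next
    case (mult h h')
    then show ?case by (simp add: mult.assoc)
  qed simp
  have "1 \<in> span ?B"
    by (rule span_base, rule image_eqI[of _ _ "(False, {})"]) (simp_all add: monomial_eqs)
  then have "h \<in> span ?B" for h using left_ideal[of h] by force
  then show ?thesis by blast
qed

text \<open>
  There are at most \<open>2\<^bsup>n+1\<^esup>\<close> monomials and they span a space of dimension \<open>2\<^bsup>n+1\<^esup>\<close>.  Hence they are
  pairwise distinct and independent.
\<close>

lemma
  shows inj_on_monomial: "inj_on (case_prod monomial) indices"
    and independent_monomials: "independent (case_prod monomial ` indices)"
proof -
  let ?B = "case_prod monomial ` indices"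
  have card: "card indices = 2 ^ (n + 1)" by (simp add: card_cartesian_product card_Pow power_add)
  have fin: "finite indices" by simp
  obtain C where C: "C \<subseteq> ?B" "independent C" "?B \<subseteq> span C" "card C = dim ?B"
    using basis_exists[of ?B] by blast
  have "dim ?B = 2 ^ (n + 1)"
    using dim_span[of ?B] by (simp add: span_monomials dimension)
  moreover have "card C \<le> card ?B" using C(1) by (intro card_mono) auto
  moreover have "card ?B \<le> card indices" by (rule card_image_le[OF fin])
  ultimately have eq: "card ?B = card indices" "card C = card ?B" using C card by simp_all
  show "inj_on (case_prod monomial) indices" by (rule eq_card_imp_inj_on[OF fin eq(1)])
  have "C = ?B" using C(1) eq(2) by (intro card_subset_eq) auto
  with C show "independent ?B" by simp
qed

lemma linear_eq_on_monomials:
  assumes "Vector_Spaces.linear sH s f" "Vector_Spaces.linear sH s f'"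
    and "\<And>j P. P \<subseteq> {1..n} \<Longrightarrow> f (monomial j P) = f' (monomial j P)"
  shows "f h = f' h"
proof -
  have "h \<in> span (case_prod monomial ` indices)" by (simp add: span_monomials)
  then show ?thesis
  proof (induction rule: span_induct_alt)
    case base
    show ?case by (simp add: linearD[OF assms(1)] linearD[OF assms(2)])
  next
    case (step c b h)
    then show ?case
      using assms(3) by (auto simp: linearD[OF assms(1)] linearD[OF assms(2)])
  qed
qed

text \<open>
  The linear functional with prescribed values on the basis of monomials.
\<close>

definition functional :: "(bool \<Rightarrow> nat set \<Rightarrow> 'k) \<Rightarrow> 'h \<Rightarrow> 'k" where
  "functional c = (SOME F. Vector_Spaces.linear sH (*) F \<and>
     (\<forall>j P. P \<subseteq> {1..n} \<longrightarrow> F (monomial j P) = c j P))"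

lemma linear_functional: "Vector_Spaces.linear sH (*) (functional c)"
  and functional_monomial: "P \<subseteq> {1..n} \<Longrightarrow> functional c (monomial j P) = c j P"
proof -
  interpret pair: vector_space_pair sH "(*) :: 'k \<Rightarrow> 'k \<Rightarrow> 'k"
    by (intro vector_space_pair.intro vector_space_H vector_space_field)
  let ?i = "inv_into indices (case_prod monomial)"
  obtain F where F: "Vector_Spaces.linear sH (*) F"
    "\<forall>b\<in>case_prod monomial ` indices. F b = case_prod c (?i b)"
    using pair.linear_independent_extend[OF independent_monomials, of "\<lambda>b. case_prod c (?i b)"]
    by blast
  have "F (monomial j P) = c j P" if P: "P \<subseteq> {1..n}" for j P
  proof -
    have "?i (case_prod monomial (j, P)) = (j, P)"
      using P by (intro inv_into_f_f inj_on_monomial) auto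
    then show ?thesis using F(2) P by force
  qed
  with F(1) have "\<exists>F. Vector_Spaces.linear sH (*) F \<and>
      (\<forall>j P. P \<subseteq> {1..n} \<longrightarrow> F (monomial j P) = c j P)" by blast
  from someI_ex[OF this] show "Vector_Spaces.linear sH (*) (functional c)"
    and "P \<subseteq> {1..n} \<Longrightarrow> functional c (monomial j P) = c j P"
    unfolding functional_def by blast+
qed

text \<open>
  The character with \<open>g \<mapsto> -1\<close> and \<open>x\<^sub>i \<mapsto> 0\<close>.  It will act on a comodule algebra as \<open>\<phi>\<close>.
\<close>

definition parity :: "'h \<Rightarrow> 'k" where
  "parity = functional (\<lambda>j P. if P = {} then if j then - 1 else 1 else 0)"

text \<open>
  The coefficient of \<open>x\<^sub>i\<close> after setting \<open>g = 1\<close>.  It will act on a comodule algebra as \<open>E\<^sub>i = d\<^sub>i \<phi>\<close>.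
\<close>

definition partial :: "nat \<Rightarrow> 'h \<Rightarrow> 'k" where
  "partial i = functional (\<lambda>j P. if P = {i} then 1 else 0)"

lemma linear_parity: "Vector_Spaces.linear sH (*) parity"
  and linear_partial: "Vector_Spaces.linear sH (*) (partial i)"
  by (simp_all add: parity_def partial_def linear_functional)

lemma parity_monomial:
    "P \<subseteq> {1..n} \<Longrightarrow> parity (monomial j P) = (if P = {} then if j then - 1 else 1 else 0)"
  and partial_monomial: "P \<subseteq> {1..n} \<Longrightarrow> partial i (monomial j P) = (if P = {i} then 1 else 0)"
  by (simp_all add: parity_def partial_def functional_monomial)

lemma parity_generators: "parity 1 = 1" "parity g = - 1" "i \<in> {1..n} \<Longrightarrow> parity (x i) = 0"
  and partial_generators: "partial k 1 = 0" "partial k g = 0"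
    "i \<in> {1..n} \<Longrightarrow> partial k (x i) = (if i = k then 1 else 0)"
  using parity_monomial[of "{}" False] parity_monomial[of "{}" True] parity_monomial[of "{i}" False]
    partial_monomial[of "{}" k False] partial_monomial[of "{}" k True] partial_monomial[of "{i}" k False]
  by (simp_all add: monomial_eqs)

lemma parity_mult: "parity (h * h') = parity h * parity h'"
proof -
  have lin: "Vector_Spaces.linear sH (*) (\<lambda>h'. parity (h * h'))"
    "Vector_Spaces.linear sH (*) (\<lambda>h'. parity h * parity h')" for h
    by (intro linearI vector_space_H vector_space_field;
        simp add: linearD[OF linear_parity] distrib_left scale_mult_right)+
  have "\<forall>h'. parity (h * h') = parity h * parity h'"
  proof (induction h rule: generated_induct)
    case g
    have "parity (g * h') = parity g * parity h'" for h'
      by (rule linear_eq_on_monomials[OF lin])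
        (simp add: monomial_eqs parity_monomial parity_generators)
    then show ?case by blast
  next
    case (x i)
    have "parity (x i * h') = parity (x i) * parity h'" for h'
    proof (rule linear_eq_on_monomials[OF lin])
      fix j P assume P: "P \<subseteq> {1..n}"
      have "parity (monomial j (insert i P)) = 0" using P x by (subst parity_monomial) auto
      then show "parity (x i * monomial j P) = parity (x i) * parity (monomial j P)"
        using x_monomial[OF P x, of j]
        by (cases "i \<in> P") (auto simp: parity_generators(3)[OF x] linearD[OF linear_parity])
    qed
    then show ?case by blast
  qed (simp_all add: parity_generators linearD[OF linear_parity] distrib_right scale_mult_left
      mult.assoc)
  then show ?thesis by blast
qed

text \<open>
  The set of all \<open>h\<close> that satisfy the rule for every \<open>h'\<close> is closed under products, so \<open>h\<close> may be
  taken to be a generator and \<open>h'\<close> a monomial.  If \<open>h = x\<^sub>i\<close> and \<open>h' = g\<^sup>j x\<^sub>P\<close> with \<open>P \<noteq> \<emptyset>\<close>, then the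
  product is \<open>0\<close> or involves at least two of the \<open>x\<^sub>k\<close>, and both sides vanish.
\<close>

lemma partial_mult: "partial k (h * h') = partial k h * parity h' + \<epsilon> h * partial k h'"
proof -
  have lin: "Vector_Spaces.linear sH (*) (\<lambda>h'. partial k (h * h'))"
    "Vector_Spaces.linear sH (*) (\<lambda>h'. partial k h * parity h' + \<epsilon> h * partial k h')" for h
    by (intro linearI vector_space_H vector_space_field;
        simp add: linearD[OF linear_parity] linearD[OF linear_partial] algebra_simps
          scale_mult_right)+
  have "\<forall>h'. partial k (h * h') = partial k h * parity h' + \<epsilon> h * partial k h'"
  proof (induction h rule: generated_induct)
    case g
    have "partial k (g * h') = partial k g * parity h' + \<epsilon> g * partial k h'" for h'
      by (rule linear_eq_on_monomials[OF lin])
        (simp add: monomial_eqs partial_monomial partial_generators counit_g)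
    then show ?case by blast
  next
    case (x i)
    have "partial k (x i * h') = partial k (x i) * parity h' + \<epsilon> (x i) * partial k h'" for h'
    proof (rule linear_eq_on_monomials[OF lin])
      fix j P assume P: "P \<subseteq> {1..n}"
      show "partial k (x i * monomial j P) =
          partial k (x i) * parity (monomial j P) + \<epsilon> (x i) * partial k (monomial j P)"
      proof (cases "P = {}")
        case True
        have "x i * monomial j {} = sH (if j then - 1 else 1) (monomial j {i})"
          using g_x[OF x]
          by (simp add: monomial_def ordered_prod_empty ordered_prod_singleton)
        then show ?thesis
          using x by (simp add: True parity_monomial partial_monomial partial_generators
              linearD[OF linear_partial] counit_x)
      next
        case False
        have "partial k (monomial j (insert i P)) = 0" if "i \<notin> P"
          using P x that False by (subst partial_monomial) auto
        with False show ?thesis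
          using x_monomial[OF P x, of j] P
          by (cases "i \<in> P") (auto simp: counit_x[OF x] parity_monomial linearD[OF linear_partial])
      qed
    qed
    then show ?case by blast
  qed (simp_all add: partial_generators parity_generators counit_one linearD[OF linear_partial]
      linearD[OF linear_counit] distrib_right scale_mult_left mult.assoc parity_mult counit_mult
      algebra_simps)
  then show ?thesis by blast
qed

end

section \<open>Skew derivations from a comodule algebra\<close>

context E_algebra
begin

text \<open>
  A functional is recovered from its action on \<open>H\<close>, by the left counit axiom.
\<close>

lemma counit_slice:
  assumes F: "Vector_Spaces.linear sH (*) F"
  shows "\<epsilon> (HH.slice F (\<Delta> h)) = F h"
proof -
  have "\<epsilon> (HH.slice F u) = F (HH.slice_left \<epsilon> u)" if "u \<in> HH.tensors" for u
    using that by (induction rule: HH.tensors_induct)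
      (simp_all add: HH.slice_simps[OF F] HH.slice_left_simps[OF linear_counit] HH.pure_in_tensors
        linearD[OF linear_counit] linearD[OF F] mult.commute)
  then show ?thesis
    using comult_counit_left[of h] by (simp add: coaction_in_tensor_space HH.slice_left_def)
qed

lemma comult_comodule_algebra: "right_comodule_algebra sH sH \<Delta> \<epsilon> \<Delta>"
  by (intro right_comodule_algebra.intro right_comodule_algebra_axioms.intro k_algebra_H
      right_comodule_axioms comult_mult comult_one)

text \<open>
  The actions of \<open>parity\<close> and \<open>partial i\<close> on \<open>H\<close> with the coaction \<open>\<Delta>\<close>: the automorphism that negates
  all generators, and the skew derivations \<open>\<partial>/\<partial>x\<^sub>i\<close>.
\<close>

definition parity_op :: "'h \<Rightarrow> 'h" where "parity_op h = HH.slice parity (\<Delta> h)"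

definition partial_op :: "nat \<Rightarrow> 'h \<Rightarrow> 'h" where "partial_op i h = HH.slice (partial i) (\<Delta> h)"

lemma counit_ops: "\<epsilon> (parity_op h) = parity h" "\<epsilon> (partial_op i h) = partial i h"
  by (simp_all add: parity_op_def partial_op_def counit_slice linear_parity linear_partial)

lemma linear_parity_op: "Vector_Spaces.linear sH sH parity_op"
  and linear_partial_op: "Vector_Spaces.linear sH sH (partial_op i)"
  unfolding parity_op_def[abs_def] partial_op_def[abs_def]
  by (intro HH.linear_slice linear_parity linear_partial linear_coaction coaction_in_tensor_space)+

end

locale E_comodule_algebra =
  E_coaction sH \<Delta> \<epsilon> S n g x sA + R: right_comodule_algebra sA sH \<Delta> \<epsilon> \<rho>
  for sH :: "'k::field \<Rightarrow> 'h::{ring,monoid_mult} \<Rightarrow> 'h"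
    and \<Delta> :: "'h \<Rightarrow> ('k, 'h, 'h) tensor" and \<epsilon> :: "'h \<Rightarrow> 'k" and S :: "'h \<Rightarrow> 'h"
    and n :: nat and g :: 'h and x :: "nat \<Rightarrow> 'h"
    and sA :: "'k \<Rightarrow> 'a::{ring,monoid_mult} \<Rightarrow> 'a"
    and \<rho> :: "'a \<Rightarrow> ('k, 'a, 'h) tensor"
begin

definition act :: "('h \<Rightarrow> 'k) \<Rightarrow> 'a \<Rightarrow> 'a" where "act F a = AH.slice F (\<rho> a)"

lemma linear_act: "Vector_Spaces.linear sH (*) F \<Longrightarrow> Vector_Spaces.linear sA sA (act F)"
  unfolding act_def[abs_def]
  by (intro AH.linear_slice R.linear_coaction R.coaction_in_tensor_space)

lemma act_counit: "act \<epsilon> a = a"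
  using R.coaction_counit[of a] by (simp add: act_def AH.slice_def)

text \<open>
  Coassociativity with \<open>F\<close> applied to the last tensor factor: \<open>\<rho>\<close> intertwines the action of \<open>F\<close> on \<open>A\<close>
  with its action on the second factor of \<open>A \<otimes> H\<close>.
\<close>

lemma coaction_act:
  assumes F: "Vector_Spaces.linear sH (*) F"
  shows "\<rho> (act F a) = tensor_map sA sH (\<lambda>a. a) (\<lambda>h. HH.slice F (\<Delta> h)) (\<rho> a)"
proof -
  note ident = linear_id_map[OF vector_space_H]
  have lin: "Vector_Spaces.linear sH sH (\<lambda>h. HH.slice F (\<Delta> h))"
    by (intro HH.linear_slice F linear_coaction coaction_in_tensor_space)
  note map_pure = tensor_map_pure[OF linear_id_map[OF A.vector_space_axioms] lin]
  have pure_left: "pure_left a (\<Delta> h) \<in> AHH.tensors"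
    "AHH.slice F (pure_left a (\<Delta> h)) = AH.pure a (HH.slice F (\<Delta> h))" for a h
    by (intro HH.tensor_map_in_tensors AH.linear_pure_right ident coaction_in_tensor_space)
      (simp add: HH.slice_tensor_map AH.linear_pure_right ident coaction_in_tensor_space F)
  have "comult_right t \<in> AHH.tensors \<and>
      AHH.slice F (comult_right t) = tensor_map sA sH (\<lambda>a. a) (\<lambda>h. HH.slice F (\<Delta> h)) t"
    if "t \<in> AH.tensors" for t
    using that by (induction rule: AH.tensors_induct)
      (simp_all add: comult_right_simps AHH.slice_simps[OF F] tensor_map_zero tensor_map_add map_pure
        AH.pure_in_tensors AHH.zero_in_tensors AHH.add_in_tensors pure_left)
  moreover have "tensor_map tensor_scale sH \<rho> (\<lambda>h. h) (\<rho> a) = comult_right (\<rho> a)"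
    using R.coaction_coassoc[of a]
    by (simp add: AH.lift_eq_tensor_map R.linear_coaction ident R.coaction_in_tensor_space
        comult_right_def)
  moreover have "AHH.slice F (tensor_map tensor_scale sH \<rho> (\<lambda>h. h) (\<rho> a)) = \<rho> (act F a)"
    by (simp add: AH.slice_tensor_map R.linear_coaction ident R.coaction_in_tensor_space F act_def)
  ultimately show ?thesis by (simp add: R.coaction_in_tensor_space)
qed

text \<open>
  Functionals act through their convolution product.  It is written with the operator of \<open>F'\<close> on \<open>H\<close>,
  so that relations between operators on \<open>H\<close> carry over to \<open>A\<close>.
\<close>

lemma act_act:
  assumes F: "Vector_Spaces.linear sH (*) F" and F': "Vector_Spaces.linear sH (*) F'"
  shows "act F (act F' a) = act (\<lambda>h. F (HH.slice F' (\<Delta> h))) a"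
proof -
  have lin: "Vector_Spaces.linear sH sH (\<lambda>h. HH.slice F' (\<Delta> h))"
    by (intro HH.linear_slice F' linear_coaction coaction_in_tensor_space)
  show ?thesis
    unfolding act_def[of F] coaction_act[OF F']
    by (simp add: AH.slice_tensor_map linear_id_map A.vector_space_axioms lin F
        R.coaction_in_tensor_space act_def)
qed

lemma act_uminus:
  assumes "Vector_Spaces.linear sH (*) F"
  shows "act (\<lambda>h. - F h) a = - act F a"
proof -
  have "Vector_Spaces.linear sH (*) (\<lambda>h. - F h)"
    by (intro linearI vector_space_H vector_space_field) (simp_all add: linearD[OF assms])
  then show ?thesis
    by (simp add: act_def AH.slice_uminus_functional assms R.coaction_in_tensor_space)
qed

lemma act_parity_mult: "act parity (a * b) = act parity a * act parity b"
proof -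
  have zero: "Vector_Spaces.linear sH (*) (\<lambda>h. 0 :: 'k)"
    by (intro linearI vector_space_H vector_space_field) simp_all
  have "AH.slice (\<lambda>h. 0) t = 0" if "t \<in> AH.tensors" for t
    using that by (induction rule: AH.tensors_induct)
      (simp_all add: AH.slice_simps[OF zero] AH.pure_in_tensors)
  then show ?thesis
    using AH.slice_mult[OF linear_parity linear_parity linear_parity zero zero, of "\<rho> a" "\<rho> b"]
    by (simp add: act_def R.coaction_mult R.coaction_in_tensor_space parity_mult)
qed

lemma act_partial_mult:
  "act (partial i) (a * b) = act (partial i) a * act parity b + a * act (partial i) b"
  using AH.slice_mult[OF linear_partial linear_partial linear_parity linear_counit linear_partial
      partial_mult R.coaction_in_tensor_space R.coaction_in_tensor_space, of i a b]
  by (simp add: act_def R.coaction_mult act_counit[unfolded act_def])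

lemma act_parity_one: "act parity 1 = 1"
  by (simp add: act_def R.coaction_one AH.slice_simps[OF linear_parity] parity_generators)

end

context E_algebra
begin

lemma ops_generators:
  "parity_op 1 = 1" "parity_op g = - g" "i \<in> {1..n} \<Longrightarrow> parity_op (x i) = - x i"
  "partial_op k 1 = 0" "partial_op k g = 0"
  "i \<in> {1..n} \<Longrightarrow> partial_op k (x i) = (if i = k then 1 else 0)"
  by (simp_all add: parity_op_def partial_op_def comult_one comult_g comult_x HH.pure_in_tensors
      HH.slice_simps[OF linear_parity] HH.slice_simps[OF linear_partial] parity_generators
      partial_generators)

lemma parity_op_mult: "parity_op (h * h') = parity_op h * parity_op h'"
  and partial_op_mult: "partial_op i (h * h') = partial_op i h * parity_op h' + h * partial_op i h'"
proof -
  interpret HR: E_comodule_algebra sH \<Delta> \<epsilon> S n g x sH \<Delta>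
    by (intro E_comodule_algebra.intro E_coaction.intro E_algebra_axioms k_algebra_H
        comult_comodule_algebra)
  show "parity_op (h * h') = parity_op h * parity_op h'"
    using HR.act_parity_mult by (simp add: HR.act_def parity_op_def)
  show "partial_op i (h * h') = partial_op i h * parity_op h' + h * partial_op i h'"
    using HR.act_partial_mult by (simp add: HR.act_def parity_op_def partial_op_def)
qed

lemma parity_op_parity_op: "parity_op (parity_op h) = h"
  by (induction h rule: generated_induct)
    (simp_all add: ops_generators linearD[OF linear_parity_op] parity_op_mult)

lemma parity_op_partial_op:
  assumes "i \<in> {1..n}"
  shows "parity_op (partial_op i h) = - partial_op i (parity_op h)"
proof (induction h rule: generated_induct)
  case (mult h h')
  then show ?case
    by (simp add: linearD[OF linear_parity_op] linearD[OF linear_partial_op] parity_op_mult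
        partial_op_mult parity_op_parity_op)
qed (simp_all add: ops_generators linearD[OF linear_parity_op] linearD[OF linear_partial_op]
    scale_minus_right)

text \<open>
  The anticommutator of two skew derivations satisfies \<open>W(h h') = W(h) h' + h W(h')\<close>, because
  \<open>parity_op\<close> is an involution that anticommutes with both of them.  As \<open>W\<close> vanishes on the
  generators, it vanishes.
\<close>

lemma partial_op_partial_op:
  assumes "i \<in> {1..n}" "j \<in> {1..n}"
  shows "partial_op i (partial_op j h) = - partial_op j (partial_op i h)"
proof (induction h rule: generated_induct)
  case (mult h h')
  have "partial_op i (parity_op h') = - parity_op (partial_op i h')" if "i \<in> {1..n}" for i
    using parity_op_partial_op[OF that, of h'] by simp
  with mult assms show ?case
    by (simp add: linearD[OF linear_partial_op] partial_op_mult parity_op_parity_op algebra_simps)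
qed (simp_all add: ops_generators linearD[OF linear_partial_op] scale_minus_right)

text \<open>
  \<open>H\<close> itself carries data of the kind classified here, with \<open>\<phi>\<close> the parity automorphism and
  \<open>E\<^sub>i = \<partial>/\<partial>x\<^sub>i\<close>.
\<close>

lemma odd_derivations_ops: "odd_derivations sH \<Delta> \<epsilon> S n g x sH parity_op partial_op"
  by (intro odd_derivations.intro odd_derivations_axioms.intro E_coaction.intro E_algebra_axioms
      k_algebra_H linear_parity_op linear_partial_op parity_op_mult partial_op_mult
      parity_op_parity_op parity_op_partial_op partial_op_partial_op ops_generators(1))

sublocale HO: odd_derivations sH \<Delta> \<epsilon> S n g x sH parity_op partial_op
  by (rule odd_derivations_ops)

text \<open>
  The reconstruction of \<open>\<rho>\<close> in the case \<open>A = H\<close>, \<open>\<rho> = \<Delta>\<close>.  Multiplicativity of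
  \<open>coact n\<close> was established in general, so only the generators need to be compared.
\<close>

lemma coact_ops: "HO.coact n h = \<Delta> h"
proof (induction h rule: generated_induct)
  note lin = linearD[OF HO.linear_coact]
  {
    case one
    show ?case by (simp add: HO.coact_one comult_one)
  next
    case g
    have "HO.coact k g = HH.pure g g" if "k \<le> n" for k
      using that
    proof (induction k)
      case 0
      have "HH.pure g e0 - HH.pure g e1 = HH.pure g g"
        by (simp only: e_diff flip: HH.pure_diff_right)
      then show ?case by (simp add: ops_generators HH.pure_uminus_left)
    next
      case (Suc k)
      then show ?case by (simp add: ops_generators lin HH.right_mult_simps)
    qed
    then show ?case by (simp add: comult_g)
  next
    case (x i)
    have "HO.coact k (x i) = HH.pure (x i) g + (if i \<le> k then HH.pure 1 (x i) else 0)"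
      if "k \<le> n" for k
      using that
    proof (induction k)
      case 0
      have "HH.pure (x i) e0 - HH.pure (x i) e1 = HH.pure (x i) g"
        by (simp only: e_diff flip: HH.pure_diff_right)
      then show ?case using x by (simp add: ops_generators HH.pure_uminus_left)
    next
      case (Suc k)
      then show ?case using x
        by (cases "i = Suc k") (auto simp: ops_generators lin HO.coact_one HH.right_mult_simps)
    qed
    then show ?case using x by (simp add: comult_x)
  next
    case (add h h')
    then show ?case by (simp add: lin linearD[OF linear_coaction])
  next
    case (scale c h)
    then show ?case by (simp add: lin linearD[OF linear_coaction])
  next
    case (mult h h')
    then show ?case by (simp add: HO.coact_mult comult_mult)
  }
qed

text \<open>
  \<open>taylor k h\<close> is the sum of \<open>\<epsilon>(\<partial>\<^sub>P h) e\<^sub>0 x\<^sub>P + parity(\<partial>\<^sub>P h) e\<^sub>1 x\<^sub>P\<close> over all \<open>P \<subseteq> {1..k}\<close>, the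
  part of the Taylor expansion of \<open>h\<close> in the first \<open>k\<close> variables.
\<close>

definition taylor :: "nat \<Rightarrow> 'h \<Rightarrow> 'h" where
  "taylor k h = HH.slice_left \<epsilon> (HO.coact k h)"

lemma taylor_0: "taylor 0 h = sH (\<epsilon> h) e0 + sH (parity h) e1"
  by (simp add: taylor_def HH.slice_left_simps[OF linear_counit] HH.pure_in_tensors counit_ops)

lemma taylor_Suc: "taylor (Suc k) h = taylor k h + taylor k (partial_op (Suc k) h) * x (Suc k)"
proof -
  have "HH.slice_left \<epsilon> (HH.right_mult y u) = HH.slice_left \<epsilon> u * y" if "u \<in> HH.tensors" for y u
    using that by (induction rule: HH.tensors_induct)
      (simp_all add: HH.slice_left_simps[OF linear_counit] HH.right_mult_simps HH.pure_in_tensors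
        HH.right_mult_in_tensors distrib_right scale_mult_left)
  then show ?thesis
    by (simp add: taylor_def HH.slice_left_simps[OF linear_counit] HO.coact_in_tensors
        HH.right_mult_in_tensors)
qed

lemma linear_taylor: "k \<le> n \<Longrightarrow> Vector_Spaces.linear sH sH (taylor k)"
  by (intro linearI vector_space_H)
    (simp_all add: taylor_def linearD[OF HO.linear_coact] HH.slice_left_simps[OF linear_counit]
      HO.coact_in_tensors)

lemma taylor_n: "taylor n h = h"
  using comult_counit_left[of h] by (simp add: taylor_def coact_ops HH.slice_left_def)

end

context E_comodule_algebra
begin

text \<open>
  By \<open>act_act\<close>, each relation on \<open>A\<close> follows from the corresponding one on \<open>H\<close> composed with \<open>\<epsilon>\<close>.
\<close>

lemma odd_derivations_act:
  "odd_derivations sH \<Delta> \<epsilon> S n g x sA (act parity) (\<lambda>i. act (partial i))"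
proof (intro odd_derivations.intro odd_derivations_axioms.intro E_coaction_axioms
    linear_act linear_parity linear_partial act_parity_mult act_parity_one act_partial_mult)
  have lin: "Vector_Spaces.linear sH (*) (\<lambda>h. F (parity_op h))"
    "Vector_Spaces.linear sH (*) (\<lambda>h. F (partial_op i h))"
    if "Vector_Spaces.linear sH (*) F" for F i
    using that linear_comp[OF linear_parity_op] linear_comp[OF linear_partial_op] by blast+
  show "act parity (act parity a) = a" for a
  proof -
    have "parity (parity_op h) = \<epsilon> h" for h
      by (simp add: parity_op_parity_op flip: counit_ops(1))
    then show ?thesis
      by (simp add: act_act linear_parity act_counit flip: parity_op_def)
  qed
  show "act parity (act (partial i) a) = - act (partial i) (act parity a)"
    if i: "i \<in> {1..n}" for i a
  proof -
    have "parity (partial_op i h) = - partial i (parity_op h)" for h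
      by (simp add: parity_op_partial_op[OF i] linearD[OF linear_counit] flip: counit_ops)
    then show ?thesis
      by (simp add: act_act linear_parity linear_partial act_uminus[OF lin(1)[OF linear_partial]]
          flip: parity_op_def partial_op_def)
  qed
  show "act (partial i) (act (partial j) a) = - act (partial j) (act (partial i) a)"
    if ij: "i \<in> {1..n}" "j \<in> {1..n}" for i j a
  proof -
    have "partial i (partial_op j h) = - partial j (partial_op i h)" for h
      using partial_op_partial_op[OF ij, of h]
      by (simp add: linearD[OF linear_counit] flip: counit_ops)
    then show ?thesis
      by (simp add: act_act linear_partial act_uminus[OF lin(2)[OF linear_partial]]
          flip: partial_op_def)
  qed
qed

sublocale RO: odd_derivations sH \<Delta> \<epsilon> S n g x sA "act parity" "\<lambda>i. act (partial i)"
  by (rule odd_derivations_act)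

text \<open>
  Both sides satisfy the same recursion in \<open>k\<close>: since \<open>\<rho>\<close> intertwines \<open>E\<^bsub>k+1\<^esub>\<close> with
  \<open>id \<otimes> \<partial>\<^bsub>k+1\<^esub>\<close>, a derivative in the second tensor factor becomes an operator on \<open>A\<close>.
\<close>

lemma tensor_map_taylor:
  "k \<le> n \<Longrightarrow> tensor_map sA sH (\<lambda>a. a) (taylor k) (\<rho> a) = RO.coact k a"
proof (induction k arbitrary: a)
  note ident = linear_id_map[OF A.vector_space_axioms]
  {
    case 0
    have lin: "Vector_Spaces.linear sH sH (\<lambda>h. sH (F h) c)"
      if "Vector_Spaces.linear sH (*) F" for F c
      by (intro linearI vector_space_H) (simp_all add: linearD[OF that] scale_left_distrib)
    have taylor: "taylor 0 = (\<lambda>h. sH (\<epsilon> h) e0 + sH (parity h) e1)"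
      by (simp add: taylor_0 fun_eq_iff)
    note map_pure = tensor_map_pure[OF ident linear_taylor[of 0, unfolded taylor]]
      tensor_map_pure[OF ident lin[OF linear_counit]] tensor_map_pure[OF ident lin[OF linear_parity]]
    have "tensor_map sA sH (\<lambda>a. a) (taylor 0) t = tensor_map sA sH (\<lambda>a. a) (\<lambda>h. sH (\<epsilon> h) e0) t +
        tensor_map sA sH (\<lambda>a. a) (\<lambda>h. sH (parity h) e1) t" if "t \<in> AH.tensors" for t
      using that by (induction rule: AH.tensors_induct)
        (simp_all add: tensor_map_zero tensor_map_add map_pure taylor AH.pure_add_right add_ac)
    then show ?case
      by (simp add: AH.tensor_map_functional linear_counit linear_parity R.coaction_in_tensor_space
          act_counit flip: act_def)
  next
    case (Suc k)
    let ?y = "x (Suc k)" and ?D = "partial_op (Suc k)"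
    have k: "k \<le> n" using Suc.prems by simp
    have taylor: "taylor (Suc k) = (\<lambda>h. taylor k h + taylor k (?D h) * ?y)"
      by (simp add: taylor_Suc fun_eq_iff)
    note map_pure = tensor_map_pure[OF ident linear_taylor[OF Suc.prems, unfolded taylor]]
      tensor_map_pure[OF ident linear_taylor[OF k]] tensor_map_pure[OF ident linear_partial_op]
    have "tensor_map sA sH (\<lambda>a. a) (taylor (Suc k)) t =
        tensor_map sA sH (\<lambda>a. a) (taylor k) t +
        AH.right_mult ?y (tensor_map sA sH (\<lambda>a. a) (taylor k) (tensor_map sA sH (\<lambda>a. a) ?D t))"
      if "t \<in> AH.tensors" for t
      using that by (induction rule: AH.tensors_induct)
        (simp_all add: tensor_map_zero tensor_map_add map_pure taylor AH.pure_add_right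
          AH.right_mult_simps add_ac)
    moreover have "tensor_map sA sH (\<lambda>a. a) ?D (\<rho> a) = \<rho> (act (partial (Suc k)) a)"
      unfolding coaction_act[OF linear_partial] partial_op_def[abs_def] ..
    ultimately show ?case
      by (simp add: R.coaction_in_tensor_space Suc.IH[OF k])
  }
qed

theorem coaction_eq_coact: "\<rho> a = RO.coact n a"
proof -
  have "taylor n = (\<lambda>h. h)" by (simp add: taylor_n fun_eq_iff)
  then show ?thesis
    using tensor_map_taylor[of n a] by (simp add: AH.tensor_map_ident R.coaction_in_tensor_space)
qed

end

section \<open>The closed formula\<close>

lemma ordered_comp_empty: "ordered_comp d {} = id"
  by (simp add: ordered_comp_def)

lemma ordered_comp_insert_max:
  assumes "finite P" "\<And>p. p \<in> P \<Longrightarrow> p < i"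
  shows "ordered_comp d (insert i P) a = ordered_comp d P (d i a)"
proof -
  have "foldr (\<circ>) fs f = foldr (\<circ>) fs id \<circ> f" for fs and f :: "'a \<Rightarrow> 'a"
    by (induction fs) (simp_all add: comp_assoc)
  from fun_cong[OF this] show ?thesis
    by (simp add: ordered_comp_def sorted_list_of_set_insert_max[OF assms]
        del: sorted_list_of_set_insert_remove)
qed

context odd_derivations
begin

text \<open>
  A subset of \<open>{1..k+1}\<close> that contains \<open>k + 1\<close> has it as its largest element, so the second summand of
  the recursion contributes exactly these subsets.
\<close>

lemma coact_eq_sum:
  "coact k a = (\<Sum>P\<in>Pow {1..k}. AH.pure (ordered_comp E P a) (e0 * ordered_prod x P) +
    AH.pure (\<phi> (ordered_comp E P a)) (e1 * ordered_prod x P))" (is "_ = (\<Sum>P\<in>_. ?t P a)")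
proof (induction k arbitrary: a)
  case 0
  show ?case by (simp add: ordered_comp_empty ordered_prod_empty)
next
  case (Suc k)
  have Pow: "Pow {1..Suc k} = Pow {1..k} \<union> insert (Suc k) ` Pow {1..k}"
  proof -
    have "{1..Suc k} = insert (Suc k) {1..k}" by auto
    then show ?thesis by (simp add: Pow_insert)
  qed
  have disj: "Pow {1..k} \<inter> insert (Suc k) ` Pow {1..k} = {}" by auto
  have inj: "inj_on (insert (Suc k)) (Pow {1..k})"
    by (rule inj_onI)
      (auto simp: set_eq_iff, (metis PowD atLeastAtMost_iff not_less_eq_eq order_refl subsetD)+)
  have sum: "AH.right_mult h (\<Sum>P\<in>I. f P) = (\<Sum>P\<in>I. AH.right_mult h (f P))"
    for h and I :: "nat set set" and f
    by (induction I rule: infinite_finite_induct) (simp_all add: AH.right_mult_simps)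
  have "AH.right_mult (x (Suc k)) (?t P (E (Suc k) a)) = ?t (insert (Suc k) P) a"
    if P: "P \<in> Pow {1..k}" for P
  proof -
    have "p < Suc k" if "p \<in> P" for p using P that by auto
    with P finite_subset_interval[of P k] show ?thesis
      by (simp add: ordered_comp_insert_max ordered_prod_insert_max AH.right_mult_simps mult.assoc)
  qed
  then have "AH.right_mult (x (Suc k)) (coact k (E (Suc k) a)) =
      (\<Sum>P\<in>insert (Suc k) ` Pow {1..k}. ?t P a)"
    unfolding Suc.IH[of "E (Suc k) a"] sum by (simp add: sum.reindex[OF inj])
  then show ?case
    unfolding Pow by (simp add: sum.union_disjoint[OF _ _ disj] Suc.IH[of a])
qed

end

context E_coaction
begin

context
  fixes \<phi> :: "'a \<Rightarrow> 'a" and d :: "nat \<Rightarrow> 'a \<Rightarrow> 'a"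
  assumes phi: "algebra_map sA sA \<phi>" and phi_phi: "\<And>a. \<phi> (\<phi> a) = a"
    and d: "\<And>i. i \<in> {1..n} \<Longrightarrow> skew_derivation sA \<phi> (d i)"
    and phi_d: "\<And>i a. i \<in> {1..n} \<Longrightarrow> \<phi> (d i a) = - d i (\<phi> a)"
    and d_d: "\<And>i j a. i \<in> {1..n} \<Longrightarrow> j \<in> {1..n} \<Longrightarrow> d i (d j a) = - d j (d i a)"
begin

lemma linear_phi: "Vector_Spaces.linear sA sA \<phi>"
  and phi_mult: "\<phi> (a * b) = \<phi> a * \<phi> b"
  and phi_one: "\<phi> 1 = 1"
  using phi by (simp_all add: algebra_map_def)

lemma linear_d: "i \<in> {1..n} \<Longrightarrow> Vector_Spaces.linear sA sA (d i)"
  and d_mult: "i \<in> {1..n} \<Longrightarrow> d i (a * b) = d i a * b + \<phi> a * d i b"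
  using d by (simp_all add: skew_derivation_def)

lemma odd_derivations_comp: "odd_derivations sH \<Delta> \<epsilon> S n g x sA \<phi> (\<lambda>i a. d i (\<phi> a))"
proof (intro odd_derivations.intro odd_derivations_axioms.intro E_coaction_axioms
    linear_phi phi_mult phi_one phi_phi linear_comp[OF linear_phi] linear_d)
  show "d i (\<phi> (a * b)) = d i (\<phi> a) * \<phi> b + a * d i (\<phi> b)" if "i \<in> {1..n}" for i a b
    by (simp add: phi_mult d_mult[OF that] phi_phi)
  show "\<phi> (d i (\<phi> a)) = - d i (\<phi> (\<phi> a))" if "i \<in> {1..n}" for i a
    by (rule phi_d[OF that])
  show "d i (\<phi> (d j (\<phi> a))) = - d j (\<phi> (d i (\<phi> a)))"
    if ij: "i \<in> {1..n}" "j \<in> {1..n}" for i j a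
    using d_d[OF ij, of a]
    by (simp add: phi_d[OF ij(1)] phi_d[OF ij(2)] phi_phi linearD[OF linear_d[OF ij(1)]]
        linearD[OF linear_d[OF ij(2)]])
qed

interpretation OD: odd_derivations sH \<Delta> \<epsilon> S n g x sA \<phi> "\<lambda>i a. d i (\<phi> a)"
  by (rule odd_derivations_comp)

text \<open>
  \<open>\<phi>\<close> commutes with \<open>d\<^sub>P\<close> up to the sign \<open>(-1)\<^bsup>|P|\<^esup>\<close>.  Compatibility with negation is part of the
  induction because each step produces one sign.
\<close>

lemma phi_ordered_comp:
  assumes "finite P" "P \<subseteq> {1..n}"
  shows "ordered_comp d P (\<phi> a) =
    (if even (card P) then \<phi> (ordered_comp d P a) else - \<phi> (ordered_comp d P a))
    \<and> ordered_comp d P (- a) = - ordered_comp d P a"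
  using assms
proof (induction P arbitrary: a rule: finite_linorder_max_induct)
  case empty
  then show ?case by (simp add: ordered_comp_empty)
next
  case (insert m P)
  then have m: "m \<in> {1..n}" and P: "P \<subseteq> {1..n}" and "m \<notin> P" by auto
  have "d m (\<phi> a) = - \<phi> (d m a)" using phi_d[OF m, of a] by simp
  then show ?case
    using insert.IH[OF P, of "d m a"] insert.IH[OF P, of "\<phi> (d m a)"] insert.hyps \<open>m \<notin> P\<close>
    by (simp add: ordered_comp_insert_max linearD[OF linear_d[OF m]])
qed

text \<open>
  The composition \<open>E\<^sub>P\<close> in terms of \<open>d\<^sub>P\<close>.  Enlarging \<open>P\<close> by a maximal element adds one \<open>\<phi>\<close>; moving
  it to the left past \<open>|P| + 1\<close> of the \<open>d\<^sub>i\<close> costs \<open>(-1)\<^bsup>|P|+1\<^esup>\<close>, and \<open>\<lfloor>(|P| + 1)/2\<rfloor>\<close>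
  accumulates these exponents modulo \<open>2\<close>.
\<close>

lemma ordered_comp_twist:
  assumes "finite P" "P \<subseteq> {1..n}"
  shows "ordered_comp (\<lambda>i a. d i (\<phi> a)) P a = sA ((- 1) ^ ((card P + 1) div 2))
    (if even (card P) then ordered_comp d P a else \<phi> (ordered_comp d P a))"
  using assms
proof (induction P arbitrary: a rule: finite_linorder_max_induct)
  case empty
  then show ?case by (simp add: ordered_comp_empty)
next
  case (insert m P)
  then have m: "m \<in> {1..n}" and P: "P \<subseteq> {1..n}" and "m \<notin> P" by auto
  have card: "card (insert m P) = Suc (card P)" using insert.hyps \<open>m \<notin> P\<close> by simp
  let ?D = "ordered_comp d P (d m a)"
  have D: "ordered_comp d P (d m (\<phi> a)) = (if even (card P) then - \<phi> ?D else \<phi> ?D)"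
  proof -
    have "d m (\<phi> a) = - \<phi> (d m a)" using phi_d[OF m, of a] by simp
    then show ?thesis
      using phi_ordered_comp[OF insert.hyps(1) P, of "d m a"]
        phi_ordered_comp[OF insert.hyps(1) P, of "\<phi> (d m a)"] by simp
  qed
  have sign: "(Suc (card P) + 1) div 2 =
      (if even (card P) then Suc ((card P + 1) div 2) else (card P + 1) div 2)"
    by (auto elim!: evenE oddE)
  show ?case
    using insert.hyps
    by (simp add: ordered_comp_insert_max insert.IH[OF P] D card sign phi_phi
        linearD[OF linear_phi] del: power_Suc)
      (simp)
qed

text \<open>
  For even \<open>|P|\<close> the two summands on the left are the \<open>e\<^sub>0\<close>- and the \<open>e\<^sub>1\<close>-part on the right, in this
  order.  For odd \<open>|P|\<close> they are swapped, in accordance with \<open>E\<^sub>P = \<plusminus> \<phi> d\<^sub>P\<close> and \<open>\<phi>\<^sup>2 = id\<close>.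
\<close>

lemma formula_eq_coact:
  "(\<Sum>P\<in>Pow {1..n}. tensor_scale ((-1) ^ ((card P + 1) div 2))
      (AH.pure (ordered_comp d P a)
         (sH (1 / 2) (ordered_prod x P + sH ((-1) ^ card P) (g * ordered_prod x P))) +
       AH.pure (\<phi> (ordered_comp d P a))
         (sH (1 / 2) (ordered_prod x P + sH ((-1) ^ (card P + 1)) (g * ordered_prod x P))))) =
   OD.coact n a"
  unfolding OD.coact_eq_sum
proof (intro sum.cong refl)
  fix P assume "P \<in> Pow {1..n}"
  then have P: "P \<subseteq> {1..n}" "finite P" using finite_subset_interval by auto
  have e: "e0 * h = sH (1 / 2) (h + g * h)" "e1 * h = sH (1 / 2) (h - g * h)" for h
    by (simp_all add: e0_def e1_def scale_mult_left algebra_simps)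
  show "tensor_scale ((-1) ^ ((card P + 1) div 2))
      (AH.pure (ordered_comp d P a)
         (sH (1 / 2) (ordered_prod x P + sH ((-1) ^ card P) (g * ordered_prod x P))) +
       AH.pure (\<phi> (ordered_comp d P a))
         (sH (1 / 2) (ordered_prod x P + sH ((-1) ^ (card P + 1)) (g * ordered_prod x P)))) =
    AH.pure (ordered_comp (\<lambda>i a. d i (\<phi> a)) P a) (e0 * ordered_prod x P) +
    AH.pure (\<phi> (ordered_comp (\<lambda>i a. d i (\<phi> a)) P a)) (e1 * ordered_prod x P)"
    unfolding ordered_comp_twist[OF P(2,1)] e
    by (cases "even (card P)")
      (simp_all add: linearD[OF linear_phi] tensor_scale_add phi_phi flip: AH.pure_scale_left)
qed

end

end

theorem theorem4p4:
  fixes n :: nat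
    and sA :: "'k::field \<Rightarrow> 'a::{ring,monoid_mult} \<Rightarrow> 'a"
    and sH :: "'k \<Rightarrow> 'h::{ring,monoid_mult} \<Rightarrow> 'h"
    and \<Delta> :: "'h \<Rightarrow> ('k, 'h, 'h) tensor" and \<epsilon> :: "'h \<Rightarrow> 'k" and S :: "'h \<Rightarrow> 'h"
    and g :: 'h and x :: "nat \<Rightarrow> 'h"
  assumes char: "CHAR('k) \<noteq> 2"
    and A: "k_algebra sA" "finite_dimensional sA"
    and H: "E_hopf_algebra sH \<Delta> \<epsilon> S n g x"
  shows "{\<rho> :: 'a \<Rightarrow> ('k, 'a, 'h) tensor. right_comodule_algebra sA sH \<Delta> \<epsilon> \<rho>} =
    {\<rho>. \<exists>(\<phi> :: 'a \<Rightarrow> 'a) (d :: nat \<Rightarrow> 'a \<Rightarrow> 'a).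
       algebra_automorphism sA \<phi> \<and> \<phi> \<circ> \<phi> = id \<and>
       (\<forall>i\<in>{1..n}. skew_derivation sA \<phi> (d i) \<and>
          (\<forall>a. d i (d i a) = 0) \<and>
          (\<forall>a. \<phi> (d i a) = - d i (\<phi> a)) \<and>
          (\<forall>j\<in>{1..n}. \<forall>a. d i (d j a) = - d j (d i a))) \<and>
       (\<forall>a. \<rho> a = (\<Sum>P\<in>Pow {1..n}. tensor_scale ((-1) ^ ((card P + 1) div 2))
          (pure_tensor sA sH (ordered_comp d P a)
             (sH (1 / 2) (ordered_prod x P + sH ((-1) ^ card P) (g * ordered_prod x P))) +
           pure_tensor sA sH (\<phi> (ordered_comp d P a))
             (sH (1 / 2) (ordered_prod x P + sH ((-1) ^ (card P + 1)) (g * ordered_prod x P))))))}"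
  (is "?coactions = {\<rho>. \<exists>\<phi> d. ?auto \<phi> \<and> ?inv \<phi> \<and> ?rel \<phi> d \<and> (\<forall>a. \<rho> a = ?formula \<phi> d a)}")
proof -
  let ?data = "\<lambda>\<phi> d. ?auto \<phi> \<and> ?inv \<phi> \<and> ?rel \<phi> d"
  have "(2 :: 'k) \<noteq> 0"
  proof
    assume "(2 :: 'k) = 0"
    then have "of_nat 2 = (0 :: 'k)" by simp
    then have dvd: "CHAR('k) dvd 2" by (simp only: of_nat_eq_0_iff_char_dvd)
    then have "CHAR('k) \<le> 2" by (rule dvd_imp_le) simp
    moreover have "CHAR('k) \<noteq> 0" using dvd_pos_nat[OF _ dvd] by simp
    ultimately have "CHAR('k) = 1" using char by linarith
    then show False using of_nat_CHAR[where 'a = 'k] by simp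
  qed
  then interpret E_coaction sH \<Delta> \<epsilon> S n g x sA
    by (intro E_coaction.intro E_algebra.intro E_algebra_axioms.intro H A(1))
  have formula: "odd_derivations sH \<Delta> \<epsilon> S n g x sA \<phi> (\<lambda>i a. d i (\<phi> a))"
    "?formula \<phi> d a = odd_derivations.coact sH g x sA \<phi> (\<lambda>i a. d i (\<phi> a)) n a"
    if "?data \<phi> d" for \<phi> d a
  proof -
    have phi: "algebra_map sA sA \<phi>" "\<phi> (\<phi> a) = a" for a
      using that by (auto simp: algebra_automorphism_def fun_eq_iff)
    have d: "skew_derivation sA \<phi> (d i)" "\<phi> (d i a) = - d i (\<phi> a)"
      if "i \<in> {1..n}" for i a using that \<open>?data \<phi> d\<close> by blast+
    have d_d: "d i (d j a) = - d j (d i a)" if "i \<in> {1..n}" "j \<in> {1..n}" for i j a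
      using that \<open>?data \<phi> d\<close> by blast
    show "odd_derivations sH \<Delta> \<epsilon> S n g x sA \<phi> (\<lambda>i a. d i (\<phi> a))"
      using odd_derivations_comp[OF phi d d_d] .
    show "?formula \<phi> d a = odd_derivations.coact sH g x sA \<phi> (\<lambda>i a. d i (\<phi> a)) n a"
      using formula_eq_coact[OF phi d d_d] .
  qed
  show ?thesis
  proof (intro set_eqI iffI; unfold mem_Collect_eq)
    fix \<rho>
    assume "\<exists>\<phi> d. ?auto \<phi> \<and> ?inv \<phi> \<and> ?rel \<phi> d \<and> (\<forall>a. \<rho> a = ?formula \<phi> d a)"
    then obtain \<phi> d where "?data \<phi> d" "\<forall>a. \<rho> a = ?formula \<phi> d a" by blast
    interpret OD: odd_derivations sH \<Delta> \<epsilon> S n g x sA \<phi> "\<lambda>i a. d i (\<phi> a)"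
      using \<open>?data \<phi> d\<close> by (rule formula)
    have "\<rho> = OD.coact n"
      using formula(2)[OF \<open>?data \<phi> d\<close>] \<open>\<forall>a. \<rho> a = ?formula \<phi> d a\<close> by (simp add: fun_eq_iff)
    then show "right_comodule_algebra sA sH \<Delta> \<epsilon> \<rho>" by (simp add: OD.coact_comodule_algebra)
  next
    fix \<rho> :: "'a \<Rightarrow> ('k, 'a, 'h) tensor" assume "right_comodule_algebra sA sH \<Delta> \<epsilon> \<rho>"
    then interpret E_comodule_algebra sH \<Delta> \<epsilon> S n g x sA \<rho>
      by (intro E_comodule_algebra.intro E_coaction_axioms)
    define \<phi> where "\<phi> = act parity"
    \<comment> \<open>As \<open>\<phi>\<close> is an involution, \<open>E\<^sub>i = d\<^sub>i \<phi>\<close> forces \<open>d\<^sub>i = E\<^sub>i \<phi>\<close>.\<close>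
    define d where "d i a = act (partial i) (\<phi> a)" for i a
    have d_phi: "(\<lambda>i a. d i (\<phi> a)) = (\<lambda>i. act (partial i))"
      by (simp add: d_def \<phi>_def RO.phi_phi fun_eq_iff)
    \<comment> \<open>\<open>d\<^sub>i d\<^sub>j = E\<^sub>i \<phi> E\<^sub>j \<phi> = - E\<^sub>i E\<^sub>j\<close>\<close>
    have dd: "d i (d j a) = - act (partial i) (act (partial j) a)"
      if i: "i \<in> {1..n}" and j: "j \<in> {1..n}" for i j a
      by (simp add: d_def \<phi>_def RO.phi_E[OF j] RO.phi_phi linearD[OF RO.linear_E[OF i]])
    have "bij \<phi>" by (rule involuntory_imp_bij) (simp add: \<phi>_def RO.phi_phi)
    then have "algebra_automorphism sA \<phi>" "\<phi> \<circ> \<phi> = id"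
      using RO.linear_phi RO.phi_mult RO.phi_one RO.phi_phi
      by (simp_all add: algebra_automorphism_def algebra_map_def \<phi>_def fun_eq_iff)
    moreover have "skew_derivation sA \<phi> (d i)" if i: "i \<in> {1..n}" for i
      using linear_comp[OF RO.linear_phi RO.linear_E[OF i]]
      by (simp add: skew_derivation_def d_def[abs_def] \<phi>_def RO.phi_mult RO.phi_phi RO.E_mult[OF i])
    moreover have "\<phi> (d i a) = - d i (\<phi> a)" if i: "i \<in> {1..n}" for i a
      by (simp add: d_def \<phi>_def RO.phi_E[OF i])
    moreover have "d i (d i a) = 0" if i: "i \<in> {1..n}" for i a
      by (simp add: dd[OF i i] RO.E_E_same[OF i])
    moreover have "d i (d j a) = - d j (d i a)" if i: "i \<in> {1..n}" and j: "j \<in> {1..n}" for i j a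
      using RO.E_E[OF i j, of a] by (simp add: dd[OF i j] dd[OF j i])
    ultimately have data: "?data \<phi> d" by (intro conjI ballI allI)
    have "\<rho> a = ?formula \<phi> d a" for a
      unfolding formula(2)[OF data] d_phi unfolding \<phi>_def by (rule coaction_eq_coact)
    with data show "\<exists>\<phi> d. ?auto \<phi> \<and> ?inv \<phi> \<and> ?rel \<phi> d \<and> (\<forall>a. \<rho> a = ?formula \<phi> d a)"
      by (intro exI[of _ \<phi>] exI[of _ d] conjI allI) (elim conjE, assumption)+
  qed
qed

end
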